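(* Let $\Omega\subset\mathbb{R}^d$ be a periodic domain and let $\phi^n\in H^2_{\mathrm{per}}(\Omega)$. Let $r>0$, let $M>0$, and let $F_M\in C^2(\mathbb{R})$ be a truncated potential satisfying $$F_M(\phi)=\tfrac14\phi^4\quad\text{for } |\phi|\le M,\qquad |F_M''(\phi)|\le L_M\quad\text{for all }\phi\in\mathbb{R},$$ for some constant $L_M$. Let $f_M=F_M'$ and define the modified energy $$E_M(\phi)=\int_\Omega\left[F_M(\phi)+\frac{1-r}{2}\phi^2-|\nabla\phi|^2+\frac12(\Delta\phi)^2\right]dx .$$ Let $a\in\mathbb{R}$ satisfy $$a\ge L_M,\qquad 1-r+a>0 .$$ Let $\Delta t>0$ and let $\phi^{n+1}\in H^2_{\mathrm{per}}(\Omega)$ be the solution of the convex splitting scheme $$\frac{\phi^{n+1}-\phi^n}{\Delta t}=\Delta\mu^{n+1},\qquad \mu^{n+1}=(1-r+a)\phi^{n+1}+\Delta^2\phi^{n+1}+f_M(\phi^n)-a\phi^n-2\Delta\phi^n ,$$ where the equations are understood in the sense of periodic distributions. Then, for every $\Delta t>0$, the discrete energy law $$E_M(\phi^{n+1})+\frac{1}{\Delta t}\|\phi^{n+1}-\phi^n\|_{H^{-1}}^2\le E_M(\phi^n)$$ holds.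
   Context: A periodic domain is a rectangular box in $\mathbb{R}^d$ with periodic boundary conditions (a flat torus), and $H^2_{\mathrm{per}}(\Omega)$ is the Sobolev space of real-valued periodic functions with square-integrable weak derivatives up to order $2$. For a mean-zero periodic function $v$ on $\Omega$, the $H^{-1}$ norm is $\|v\|_{H^{-1}}=\|\nabla\psi\|_{L^2(\Omega)}$, where $\psi$ is the mean-zero periodic solution of $-\Delta\psi=v$; the associated inner product satisfies $\langle \Delta v,w\rangle_{H^{-1}}=-\langle v,w\rangle_{L^2}$ for mean-zero $w$. The difference $\phi^{n+1}-\phi^n$ has mean zero, since it equals $\Delta t\,\Delta\mu^{n+1}$ with $\mu^{n+1}$ periodic. The parameter $r>0$ is the undercooling parameter of the phase field crystal equation, $a$ is the splitting parameter and $\Delta t$ is the time step. The scheme comes from the decomposition $E_M=E_M^++E_M^-$ with $E_M^+(\phi)=\int_\Omega\left[\frac{1-r+a}{2}\phi^2+\frac12(\Delta\phi)^2\right]dx$ treated implicitly and $E_M^-(\phi)=\int_\Omega\left[F_M(\phi)-\frac a2\phi^2-|\nabla\phi|^2\right]dx$ treated explicitly.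
   Formalization: The scheme is taken with +2Δφ^n instead of −2Δφ^n in μ^{n+1}, as the stated explicit part E_M^- requires; with the minus sign the energy law fails (e.g. d=1, Ω=[0,2π], r=1, M=1, a=L_M=3, φ^n=ε cos x with small ε). *)

theory Defs
  imports "HOL-Analysis.Analysis"
begin

text \<open>
  The flat torus is the box \<open>cbox lo hi\<close> with opposite faces identified.  Functions on it are
  functions on the whole space that are periodic in every coordinate direction; \<open>L\<^sup>2\<close> functions are
  represented by such functions, not by equivalence classes.
\<close>

definition box_periodic :: "real^'n \<Rightarrow> real^'n \<Rightarrow> (real^'n \<Rightarrow> real) \<Rightarrow> bool" where
  "box_periodic lo hi f \<longleftrightarrow> (\<forall>x i. f (x + axis i (hi $ i - lo $ i)) = f x)"

definition pdiff :: "'n \<Rightarrow> (real^'n \<Rightarrow> real) \<Rightarrow> real^'n \<Rightarrow> real" where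
  "pdiff i f = (\<lambda>x. frechet_derivative f (at x) (axis i 1))"

definition pdiffs :: "'n list \<Rightarrow> (real^'n \<Rightarrow> real) \<Rightarrow> real^'n \<Rightarrow> real" where
  "pdiffs is f = foldr pdiff is f"

definition laplacian :: "(real^'n \<Rightarrow> real) \<Rightarrow> real^'n \<Rightarrow> real" where
  "laplacian f = (\<lambda>x. \<Sum>i\<in>UNIV. pdiffs [i, i] f x)"

text \<open>
  Periodic test functions are the smooth ones: if all iterated partial derivatives are everywhere
  differentiable, they are in particular continuous.
\<close>

definition test_functions :: "real^'n \<Rightarrow> real^'n \<Rightarrow> (real^'n \<Rightarrow> real) set" where
  "test_functions lo hi =
     {\<eta>. box_periodic lo hi \<eta> \<and> (\<forall>is. pdiffs is \<eta> differentiable_on UNIV)}"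

definition box_integral :: "real^'n \<Rightarrow> real^'n \<Rightarrow> (real^'n \<Rightarrow> real) \<Rightarrow> real" where
  "box_integral lo hi f = (LINT x:cbox lo hi|lebesgue. f x)"

definition L2_per :: "real^'n \<Rightarrow> real^'n \<Rightarrow> (real^'n \<Rightarrow> real) set" where
  "L2_per lo hi =
     {f. box_periodic lo hi f \<and> f \<in> borel_measurable lebesgue \<and>
         set_integrable lebesgue (cbox lo hi) (\<lambda>x. (f x)\<^sup>2)}"

text \<open>
  Higher derivatives are indexed by the list of directions of differentiation rather than by a
  multi-index; the order of the list is irrelevant because partial derivatives of test functions
  commute.
\<close>

definition is_weak_deriv ::
  "real^'n \<Rightarrow> real^'n \<Rightarrow> 'n list \<Rightarrow> (real^'n \<Rightarrow> real) \<Rightarrow> (real^'n \<Rightarrow> real) \<Rightarrow> bool" where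
  "is_weak_deriv lo hi is f g \<longleftrightarrow>
     (\<forall>\<eta>\<in>test_functions lo hi.
        box_integral lo hi (\<lambda>x. f x * pdiffs is \<eta> x) =
        (-1) ^ length is * box_integral lo hi (\<lambda>x. g x * \<eta> x))"

definition H_per :: "nat \<Rightarrow> real^'n \<Rightarrow> real^'n \<Rightarrow> (real^'n \<Rightarrow> real) set" where
  "H_per k lo hi =
     {f \<in> L2_per lo hi.
        \<forall>is. length is \<le> k \<longrightarrow> (\<exists>g\<in>L2_per lo hi. is_weak_deriv lo hi is f g)}"

text \<open>
  A weak derivative is determined only up to a null set, so any choice of representative gives the
  same integrals below.
\<close>

definition weak_deriv ::
  "real^'n \<Rightarrow> real^'n \<Rightarrow> 'n list \<Rightarrow> (real^'n \<Rightarrow> real) \<Rightarrow> real^'n \<Rightarrow> real" where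
  "weak_deriv lo hi is f = (SOME g. g \<in> L2_per lo hi \<and> is_weak_deriv lo hi is f g)"

definition weak_grad :: "real^'n \<Rightarrow> real^'n \<Rightarrow> (real^'n \<Rightarrow> real) \<Rightarrow> real^'n \<Rightarrow> real^'n" where
  "weak_grad lo hi f = (\<lambda>x. \<chi> i. weak_deriv lo hi [i] f x)"

definition weak_laplacian :: "real^'n \<Rightarrow> real^'n \<Rightarrow> (real^'n \<Rightarrow> real) \<Rightarrow> real^'n \<Rightarrow> real" where
  "weak_laplacian lo hi f = (\<lambda>x. \<Sum>i\<in>UNIV. weak_deriv lo hi [i, i] f x)"

text \<open>
  Periodic distributions are represented by functionals on functions, of which only the values on
  \<open>test_functions\<close> matter.  There is no sign in \<open>distr_laplacian\<close> since the Laplacian has even order.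
\<close>

type_synonym 'n distribution = "(real^'n \<Rightarrow> real) \<Rightarrow> real"

definition distr_of :: "real^'n \<Rightarrow> real^'n \<Rightarrow> (real^'n \<Rightarrow> real) \<Rightarrow> 'n distribution" where
  "distr_of lo hi f = (\<lambda>\<eta>. box_integral lo hi (\<lambda>x. f x * \<eta> x))"

definition distr_laplacian :: "'n::finite distribution \<Rightarrow> 'n distribution" where
  "distr_laplacian T = (\<lambda>\<eta>. T (laplacian \<eta>))"

definition poisson_solution ::
  "real^'n \<Rightarrow> real^'n \<Rightarrow> (real^'n \<Rightarrow> real) \<Rightarrow> (real^'n \<Rightarrow> real) \<Rightarrow> bool" where
  "poisson_solution lo hi v \<psi> \<longleftrightarrow>
     \<psi> \<in> H_per 1 lo hi \<and> box_integral lo hi \<psi> = 0 \<and>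
     (\<forall>\<eta>\<in>test_functions lo hi.
        - distr_laplacian (distr_of lo hi \<psi>) \<eta> = distr_of lo hi v \<eta>)"

text \<open>
  For mean-zero \<open>v\<close> in \<open>L\<^sup>2\<close> the solution exists and is unique up to a null set; the norm is
  unspecified when there is no solution.
\<close>

definition Hm1_norm :: "real^'n \<Rightarrow> real^'n \<Rightarrow> (real^'n \<Rightarrow> real) \<Rightarrow> real" where
  "Hm1_norm lo hi v =
     (let \<psi> = (SOME \<psi>. poisson_solution lo hi v \<psi>)
      in sqrt (box_integral lo hi (\<lambda>x. (norm (weak_grad lo hi \<psi> x))\<^sup>2)))"

definition C2_function :: "(real \<Rightarrow> real) \<Rightarrow> bool" where
  "C2_function F \<longleftrightarrow>
     F differentiable_on UNIV \<and> deriv F differentiable_on UNIV \<and>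
     continuous_on UNIV (deriv (deriv F))"

definition energy ::
  "real^'n \<Rightarrow> real^'n \<Rightarrow> (real \<Rightarrow> real) \<Rightarrow> real \<Rightarrow> (real^'n \<Rightarrow> real) \<Rightarrow> real" where
  "energy lo hi F r \<phi> =
     box_integral lo hi (\<lambda>x. F (\<phi> x) + (1 - r) / 2 * (\<phi> x)\<^sup>2
       - (norm (weak_grad lo hi \<phi> x))\<^sup>2 + 1 / 2 * (weak_laplacian lo hi \<phi> x)\<^sup>2)"

text \<open>
  The chemical potential of the convex splitting scheme, as a periodic distribution: the variational
  derivative at \<open>\<phi>'\<close> of the implicit part \<open>\<integral> (1-r+a)/2 \<phi>\<^sup>2 + 1/2 (\<Delta>\<phi>)\<^sup>2\<close> of the energy plus the
  variational derivative at \<open>\<phi>\<close> of the explicit part \<open>\<integral> F(\<phi>) - a/2 \<phi>\<^sup>2 - |\<nabla>\<phi>|\<^sup>2\<close>.  The term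
  \<open>-|\<nabla>\<phi>|\<^sup>2\<close> contributes \<open>+2 \<Delta>\<phi>\<close>, after integration by parts; with \<open>-2 \<Delta>\<phi>\<close> instead the scheme
  would not dissipate the energy.
\<close>

definition chemical_potential ::
  "real^'n \<Rightarrow> real^'n \<Rightarrow> (real \<Rightarrow> real) \<Rightarrow> real \<Rightarrow> real \<Rightarrow>
   (real^'n \<Rightarrow> real) \<Rightarrow> (real^'n \<Rightarrow> real) \<Rightarrow> 'n distribution" where
  "chemical_potential lo hi F r a \<phi> \<phi>' = (\<lambda>\<eta>.
     (1 - r + a) * distr_of lo hi \<phi>' \<eta>
     + distr_laplacian (distr_laplacian (distr_of lo hi \<phi>')) \<eta>
     + distr_of lo hi (\<lambda>x. deriv F (\<phi> x)) \<eta>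
     - a * distr_of lo hi \<phi> \<eta>
     + 2 * distr_laplacian (distr_of lo hi \<phi>) \<eta>)"

end

theory Submission
  imports Defs
begin

text \<open>
  The energy law is proved one Fourier mode at a time.  With \<open>\<kappa>\<^sub>i = 2 \<pi> k\<^sub>i / (hi\<^sub>i - lo\<^sub>i)\<close> for an
  integer vector \<open>k\<close>, the functions \<open>cos (\<kappa> \<bullet> x) + sin (\<kappa> \<bullet> x)\<close>, divided by the square root of the
  volume, form a real orthonormal basis of \<open>L\<^sup>2\<close> of the torus (Hartley's variant of the Fourier basis).
  They are test functions and eigenfunctions of the Laplacian, with eigenvalue \<open>- q\<close> where
  \<open>q = |\<kappa>|\<^sup>2\<close>.  Write \<open>p\<close>, \<open>p'\<close>, \<open>b\<close> for the coefficients of \<open>\<phi>\<close>, \<open>\<phi>'\<close>, \<open>F' (\<phi>)\<close> and \<open>w = p' - p\<close>.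
  Tested against a mode, the scheme says
  \<open>w / dt = - q m\<close> with \<open>m = (1 - r + a) p' + q\<^sup>2 p' + b - a p - 2 q p\<close>.

  By Parseval's identity the quadratic terms of the energy are sums over the modes, with weights
  \<open>1\<close>, \<open>q\<close> and \<open>q\<^sup>2\<close>.  The potential is not quadratic, but Taylor's formula and \<open>|F''| \<le> L \<le> a\<close>
  bound the increment of its integral by the integral of
  \<open>F' (\<phi>) (\<phi>' - \<phi>) + a / 2 (\<phi>' - \<phi>)\<^sup>2\<close>, which Parseval's identity covers again.  Hence the increment
  of the energy is at most a sum over the modes, and its summand turns out to be
  \<open>m w - ((1 - r + a) / 2 + q + q\<^sup>2 / 2) w\<^sup>2\<close>: this is where the convex splitting pays off, since the
  bracket is positive.  The scheme turns \<open>m w\<close> into \<open>- (1 / dt) w\<^sup>2 / q\<close>, and the sum of \<open>w\<^sup>2 / q\<close> is the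
  square of the \<open>H\<^sup>-\<^sup>1\<close> norm of \<open>\<phi>' - \<phi>\<close> (lemmas \<open>energy_law_modewise\<close> and \<open>Hm1_norm_Parseval\<close>).

  The analytic core is that the modes are complete and that coefficients can be prescribed.
  Completeness comes from the Stone--Weierstrass theorem, applied on the product of circles onto which
  the box is wrapped, and from the density of continuous functions (\<open>AE_eq_0_if_coef_eq_0\<close>).  The
  theorem of Riesz and Fischer realises every square summable family as the coefficients of a
  function in \<open>L\<^sup>2\<close>.  The two together yield Parseval's identity, and the second one also
  yields the solution \<open>\<psi>\<close> of \<open>- \<Delta> \<psi> = v\<close> with its weak gradient: its coefficients are those of \<open>v\<close>
  divided by \<open>q\<close>.
\<close>

section \<open>Integration by parts on the torus\<close>

lemma axis_eq_scaleR: "(axis i s :: real^'n) = s *\<^sub>R axis i 1"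
  by (auto simp: axis_def vec_eq_iff)

lemma differentiable_along_axis:
  fixes h :: "real^'n \<Rightarrow> real"
  assumes "h differentiable at (x + axis i t)"
  shows "((\<lambda>s. h (x + axis i s)) has_field_derivative pdiff i h (x + axis i t)) (at t within U)"
proof -
  have 1: "(h has_derivative frechet_derivative h (at (x + axis i t))) (at (x + axis i t))"
    using assms frechet_derivative_works by blast
  have bl: "bounded_linear (\<lambda>s::real. axis i s :: real^'n)"
    by (subst axis_eq_scaleR) (rule bounded_linear_scaleR_left)
  have d: "((\<lambda>s::real. x + axis i s :: real^'n) has_derivative (\<lambda>s. axis i s)) (at t within U)"
    using has_derivative_add[OF has_derivative_const[where c=x]
        bounded_linear.has_derivative[OF bl has_derivative_ident]] by simp
  have "((\<lambda>s. h (x + axis i s)) has_derivative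
      (\<lambda>s. frechet_derivative h (at (x + axis i t)) (axis i s))) (at t within U)"
    by (rule has_derivative_compose[OF d 1])
  moreover have "frechet_derivative h (at (x + axis i t)) (axis i s) = s * pdiff i h (x + axis i t)" for s
  proof -
    have "linear (frechet_derivative h (at (x + axis i t)))"
      using 1 has_derivative_linear by blast
    then show ?thesis
      by (subst axis_eq_scaleR) (simp add: linear_cmul pdiff_def)
  qed
  ultimately show ?thesis
    by (simp only: has_field_derivative_def mult_commute_abs)
qed

locale torus =
  fixes lo hi :: "real^'n"
  assumes lo_less_hi: "lo $ i < hi $ i"
begin

abbreviation M where "M \<equiv> lebesgue_on (cbox lo hi)"

lemma box_integral_eq: "box_integral lo hi f = integral\<^sup>L M f"
  by (simp add: box_integral_def set_lebesgue_integral_def integral_restrict_space)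

lemma box_integral_continuous:
  fixes f :: "real^'n \<Rightarrow> real"
  assumes "continuous_on UNIV f"
  shows "integrable M f" "integral\<^sup>L M f = integral (cbox lo hi) f"
proof -
  have "continuous_on (cbox lo hi) f" using assms continuous_on_subset by blast
  then have i: "integrable M f"
    by (rule continuous_imp_integrable)
  then show "integrable M f" .
  from i show "integral\<^sup>L M f = integral (cbox lo hi) f"
    by (rule lebesgue_integral_eq_integral) auto
qed

text \<open>
  The translated box is cut at the face \<open>x\<^sub>i = hi\<^sub>i\<close>; by periodicity the part beyond that face can be
  moved back by one period, where it fills the gap left at the opposite face.
\<close>

lemma integral_translate_periodic:
  fixes h :: "real^'n \<Rightarrow> real"
  assumes per: "box_periodic lo hi h" and cont: "continuous_on UNIV h"
    and t: "0 \<le> t" "t \<le> hi $ i - lo $ i"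
  shows "integral (cbox lo hi) (\<lambda>x. h (x + axis i t)) = integral (cbox lo hi) h"
proof -
  define l where "l = hi $ i - lo $ i"
  have e: "axis i 1 \<in> (Basis :: (real^'n) set)"
    by simp
  have int: "h integrable_on cbox a b" for a b
    using cont continuous_on_subset integrable_continuous by blast
  \<comment> \<open>The boxes compared below differ only in their extent along the \<open>i\<close>-th axis.\<close>
  have mem: "x \<in> cbox a b \<longleftrightarrow> (a $ i \<le> x $ i \<and> x $ i \<le> b $ i) \<and> (\<forall>j. j \<noteq> i \<longrightarrow> a $ j \<le> x $ j \<and> x $ j \<le> b $ j)"
    for a b x :: "real^'n"
    unfolding mem_box_cart by metis
  have ax: "(axis i c :: real^'n) $ j = (if j = i then c else 0)" "x \<bullet> axis i 1 = x $ i"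
    for c :: real and j and x :: "real^'n"
    by (simp add: axis_def, simp only: cart_eq_inner_axis)
  have L1: "cbox lo hi \<inter> {x. x \<bullet> axis i 1 \<le> lo $ i + t} = cbox lo (axis i (t - l) + hi)"
    using t by (intro set_eqI) (auto simp: mem ax l_def)
  have L2: "cbox lo hi \<inter> {x. x \<bullet> axis i 1 \<ge> lo $ i + t} = cbox (axis i t + lo) hi"
    using t by (intro set_eqI) (auto simp: mem ax l_def)
  have R1: "cbox (axis i t + lo) (axis i t + hi) \<inter> {x. x \<bullet> axis i 1 \<le> hi $ i} = cbox (axis i t + lo) hi"
    using t by (intro set_eqI) (auto simp: mem ax l_def)
  have R2: "cbox (axis i t + lo) (axis i t + hi) \<inter> {x. x \<bullet> axis i 1 \<ge> hi $ i}
      = cbox (axis i l + lo) (axis i l + (axis i (t - l) + hi))"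
    using t by (intro set_eqI) (auto simp: mem ax l_def)
  have "integral (cbox lo hi) (\<lambda>x. h (x + axis i t))
      = integral (cbox (axis i t + lo) (axis i t + hi)) h"
    using integral_shift_cbox_plus[of lo hi h "axis i t"] by (simp add: add.commute o_def)
  also have "\<dots> = integral (cbox (axis i t + lo) hi) h
      + integral (cbox (axis i l + lo) (axis i l + (axis i (t - l) + hi))) h"
    by (subst integral_split[OF int e, of _ _ "hi $ i"]) (simp only: R1 R2)
  also have "integral (cbox (axis i l + lo) (axis i l + (axis i (t - l) + hi))) h
      = integral (cbox lo (axis i (t - l) + hi)) (\<lambda>x. h (x + axis i l))"
    using integral_shift_cbox_plus[of lo "axis i (t - l) + hi" h "axis i l"] by (simp add: add.commute o_def)
  also have "\<dots> = integral (cbox lo (axis i (t - l) + hi)) h"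
    using per by (simp add: box_periodic_def l_def)
  also have "integral (cbox (axis i t + lo) hi) h + \<dots> = integral (cbox lo hi) h"
    using integral_split[OF int e, of lo hi "lo $ i + t"] by (simp only: L1 L2)
  finally show ?thesis .
qed

text \<open>
  The integral over the box of a translate along the \<open>i\<close>-th axis does not depend on the translation,
  so its derivative, which is the integral of the partial derivative, vanishes.
\<close>

lemma integral_pdiff_eq_0:
  fixes h :: "real^'n \<Rightarrow> real"
  assumes per: "box_periodic lo hi h" and diff: "h differentiable_on UNIV"
    and cont: "continuous_on UNIV (pdiff i h)"
  shows "integral (cbox lo hi) (pdiff i h) = 0"
proof -
  define l where "l = hi $ i - lo $ i"
  have l: "l > 0" using lo_less_hi by (simp add: l_def)
  have ch: "continuous_on UNIV h"
    using diff differentiable_imp_continuous_on by blast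
  have cax: "continuous_on UNIV (\<lambda>(t::real, x::real^'n). x + axis i t)"
    unfolding case_prod_unfold by (subst axis_eq_scaleR) (intro continuous_intros)
  have J: "((\<lambda>t. integral (cbox lo hi) (\<lambda>x. h (x + axis i t))) has_field_derivative
      integral (cbox lo hi) (\<lambda>x. pdiff i h (x + axis i 0))) (at 0 within {0..l})"
  proof (rule leibniz_rule_field_derivative)
    show "((\<lambda>t. h (x + axis i t)) has_field_derivative pdiff i h (x + axis i t)) (at t within {0..l})" for t x
      using diff by (intro differentiable_along_axis) (auto simp: differentiable_on_def)
    show "(\<lambda>x. h (x + axis i t)) integrable_on cbox lo hi" for t
      by (rule integrable_continuous, rule continuous_on_compose2[OF ch]) (auto intro: continuous_on_add continuous_on_id continuous_on_const)
    show "continuous_on ({0..l} \<times> cbox lo hi) (\<lambda>(t, x). pdiff i h (x + axis i t))"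
      using continuous_on_compose2[OF cont continuous_on_subset[OF cax], of "{0..l} \<times> cbox lo hi"]
      by (simp add: case_prod_unfold)
  qed (use l in auto)
  have "((\<lambda>t. integral (cbox lo hi) (\<lambda>x. h (x + axis i t))) has_field_derivative 0) (at 0 within {0..l})"
  proof (rule has_field_derivative_transform_within[where f="\<lambda>t. integral (cbox lo hi) h" and d=1])
    show "integral (cbox lo hi) h = integral (cbox lo hi) (\<lambda>x. h (x + axis i t))" if "t \<in> {0..l}" for t
      using that integral_translate_periodic[OF per ch] by (simp add: l_def)
  qed (use l in auto)
  with J have "integral (cbox lo hi) (\<lambda>x. pdiff i h (x + axis i 0)) = 0"
    by (rule has_field_derivative_unique) (simp add: at_within_Icc_at_right[OF l] trivial_limit_at_right_real)
  moreover have "axis i 0 = (0 :: real^'n)"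
    by (simp add: axis_def vec_eq_iff)
  ultimately show ?thesis by simp
qed

lemma test_functionsD:
  assumes "\<eta> \<in> test_functions lo hi"
  shows "box_periodic lo hi \<eta>" "pdiffs is \<eta> differentiable_on UNIV" "\<eta> differentiable_on UNIV"
    "continuous_on UNIV \<eta>" "pdiff i \<eta> differentiable_on UNIV" "continuous_on UNIV (pdiff i \<eta>)"
proof -
  show *: "box_periodic lo hi \<eta>" "pdiffs is \<eta> differentiable_on UNIV" for "is"
    using assms by (auto simp: test_functions_def)
  show 1: "\<eta> differentiable_on UNIV" "pdiff i \<eta> differentiable_on UNIV"
    using *(2)[of "[]"] *(2)[of "[i]"] by (simp_all add: pdiffs_def)
  show "continuous_on UNIV \<eta>" "continuous_on UNIV (pdiff i \<eta>)"
    using 1 differentiable_imp_continuous_on by blast+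
qed

lemma box_periodic_pdiff:
  assumes "box_periodic lo hi h" and "h differentiable_on UNIV"
  shows "box_periodic lo hi (pdiff i h)"
  unfolding box_periodic_def
proof (intro allI)
  fix x :: "real^'n" and j :: 'n
  define p :: "real^'n" where "p = axis j (hi $ j - lo $ j)"
  have h: "(\<lambda>x. h (x + p)) = h"
    using assms(1) by (simp add: box_periodic_def p_def)
  have "(h has_derivative frechet_derivative h (at (x + p))) (at (x + p))"
    using assms(2) frechet_derivative_works by (auto simp: differentiable_on_def)
  moreover have "((\<lambda>x. x + p) has_derivative (\<lambda>v. v)) (at x)"
    by (auto intro!: derivative_eq_intros)
  ultimately have "((\<lambda>x. h (x + p)) has_derivative frechet_derivative h (at (x + p))) (at x)"
    using has_derivative_compose by blast
  then show "pdiff i h (x + axis j (hi $ j - lo $ j)) = pdiff i h x"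
    unfolding h pdiff_def p_def[symmetric] by (metis frechet_derivative_at)
qed

lemma test_functions_pdiff:
  assumes "\<eta> \<in> test_functions lo hi"
  shows "pdiff i \<eta> \<in> test_functions lo hi"
proof -
  have "pdiffs is (pdiff i \<eta>) = pdiffs (is @ [i]) \<eta>" for "is"
    by (simp add: pdiffs_def)
  then show ?thesis
    using test_functionsD[OF assms] box_periodic_pdiff by (simp add: test_functions_def)
qed

lemma integral_by_parts:
  fixes u v :: "real^'n \<Rightarrow> real"
  assumes u: "u \<in> test_functions lo hi" and v: "v \<in> test_functions lo hi"
  shows "integral\<^sup>L M (\<lambda>x. u x * pdiff i v x) = - integral\<^sup>L M (\<lambda>x. pdiff i u x * v x)"
proof -
  note U = test_functionsD[OF u] and V = test_functionsD[OF v]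
  have pd: "pdiff i (\<lambda>x. u x * v x) = (\<lambda>x. u x * pdiff i v x + pdiff i u x * v x)"
  proof
    fix x
    have "(u has_derivative frechet_derivative u (at x)) (at x)"
      "(v has_derivative frechet_derivative v (at x)) (at x)"
      using U(3) V(3) frechet_derivative_works by (auto simp: differentiable_on_def)
    from has_derivative_mult[OF this]
    show "pdiff i (\<lambda>x. u x * v x) x = u x * pdiff i v x + pdiff i u x * v x"
      unfolding pdiff_def by (subst frechet_derivative_at[symmetric]) auto
  qed
  have "integral\<^sup>L M (\<lambda>x. u x * pdiff i v x + pdiff i u x * v x)
      = integral (cbox lo hi) (pdiff i (\<lambda>x. u x * v x))"
    unfolding pd by (intro box_integral_continuous continuous_intros U V)
  also have "\<dots> = 0"
  proof (rule integral_pdiff_eq_0)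
    show "box_periodic lo hi (\<lambda>x. u x * v x)"
      using U(1) V(1) by (simp add: box_periodic_def)
    show "(\<lambda>x. u x * v x) differentiable_on UNIV"
      using U(3) V(3) by (simp add: differentiable_on_def)
    show "continuous_on UNIV (pdiff i (\<lambda>x. u x * v x))"
      unfolding pd by (intro continuous_intros U V)
  qed
  finally show ?thesis
    by (subst (asm) Bochner_Integration.integral_add)
      (auto intro!: box_integral_continuous continuous_intros U V)
qed

section \<open>The orthonormal system of modes\<close>

definition freq :: "int^'n \<Rightarrow> 'n \<Rightarrow> real" where
  "freq k i = 2 * pi * of_int (k $ i) / (hi $ i - lo $ i)"

definition phase :: "int^'n \<Rightarrow> real^'n \<Rightarrow> real" where
  "phase k x = (\<Sum>i\<in>UNIV. freq k i * x $ i)"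

abbreviation vol :: real where "vol \<equiv> measure lebesgue (cbox lo hi)"

text \<open>
  Hartley's function cas is the sum of cosine and sine.  It gives a real orthonormal basis indexed by
  all integer vectors, where cosines and sines taken separately would need half of the vectors each.
\<close>

definition cas_mode :: "int^'n \<Rightarrow> real^'n \<Rightarrow> real" where
  "cas_mode k x = (cos (phase k x) + sin (phase k x)) / sqrt vol"

lemma vol_pos: "vol > 0"
  using lo_less_hi by (simp add: content_cbox_if_cart prod_pos less_imp_le interval_ne_empty_cart)

lemma freq_simps [simp]:
  "freq 0 i = 0" "freq (- k) i = - freq k i" "freq (k + l) i = freq k i + freq l i"
  "freq (k - l) i = freq k i - freq l i"
  by (simp_all add: freq_def ring_distribs add_divide_distrib diff_divide_distrib)

lemma freq_eq_0_iff: "(\<forall>i. freq k i = 0) \<longleftrightarrow> k = 0"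
proof -
  have "hi $ i - lo $ i \<noteq> 0" for i using lo_less_hi[of i] by simp
  then show ?thesis by (simp add: freq_def vec_eq_iff)
qed

lemma phase_simps [simp]:
  "phase 0 x = 0" "phase (- k) x = - phase k x" "phase (k + l) x = phase k x + phase l x"
  "phase (k - l) x = phase k x - phase l x"
  by (simp_all add: phase_def sum_negf sum.distrib sum_subtractf ring_distribs)

lemma phase_add: "phase k (x + y) = phase k x + phase k y"
  by (simp add: phase_def ring_distribs sum.distrib)

lemma phase_axis: "phase k (axis i c) = freq k i * c"
  by (simp add: phase_def axis_def if_distrib cong: if_cong)

lemma cas_mode_periodic: "box_periodic lo hi (cas_mode k)"
  unfolding box_periodic_def
proof (intro allI)
  fix x :: "real^'n" and i
  have "hi $ i - lo $ i \<noteq> 0" using lo_less_hi[of i] by simp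
  then have "phase k (x + axis i (hi $ i - lo $ i)) = phase k x + of_int (k $ i) * (2 * pi)"
    by (simp add: phase_add phase_axis freq_def)
  then show "cas_mode k (x + axis i (hi $ i - lo $ i)) = cas_mode k x"
    by (simp add: cas_mode_def cos_add sin_add)
       (simp add: mult.commute[of _ "2 * pi"] sin_int_2pin cos_int_2pin)
qed

lemma cas_mode_has_derivative:
  "(cas_mode k has_derivative (\<lambda>v. cas_mode (- k) x * phase k v)) (at x)"
proof -
  have "(phase k has_derivative phase k) (at x)"
    unfolding phase_def
    by (intro has_derivative_sum has_derivative_mult_right
        bounded_linear_imp_has_derivative bounded_linear_vec_nth)
  from has_derivative_add[OF has_derivative_cos[OF this] has_derivative_sin[OF this]]
  have "((\<lambda>x. (cos (phase k x) + sin (phase k x)) / sqrt vol) has_derivative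
      (\<lambda>v. (phase k v * - sin (phase k x) + phase k v * cos (phase k x)) / sqrt vol)) (at x)"
    by (rule bounded_linear.has_derivative[OF bounded_linear_divide])
  moreover have "(\<lambda>v. (phase k v * - sin (phase k x) + phase k v * cos (phase k x)) / sqrt vol)
      = (\<lambda>v. cas_mode (- k) x * phase k v)"
    by (auto simp: cas_mode_def algebra_simps)
  ultimately show ?thesis
    by (simp add: cas_mode_def[abs_def])
qed

text \<open>
  The derivative of \<open>cos t + sin t\<close> is its value at \<open>- t\<close>.  Hence multiples of modes are closed under
  differentiation, which is why they are test functions, and two equal derivatives in a row return to
  the same mode.
\<close>

lemma pdiff_scaled_cas_mode:
  "pdiff i (\<lambda>x. c * cas_mode k x) = (\<lambda>x. (c * freq k i) * cas_mode (- k) x)"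
proof
  fix x
  have "((\<lambda>x. c * cas_mode k x) has_derivative (\<lambda>v. c * (cas_mode (- k) x * phase k v))) (at x)"
    by (intro has_derivative_mult_right cas_mode_has_derivative)
  note deriv = frechet_derivative_at[OF this]
  show "pdiff i (\<lambda>x. c * cas_mode k x) x = (c * freq k i) * cas_mode (- k) x"
    unfolding pdiff_def by (subst deriv[symmetric]) (simp add: phase_axis)
qed

lemma pdiff_cas_mode: "pdiff i (cas_mode k) = (\<lambda>x. freq k i * cas_mode (- k) x)"
  using pdiff_scaled_cas_mode[of i 1 k] by simp

lemma pdiffs_twice_cas_mode: "pdiffs [i, i] (cas_mode k) = (\<lambda>x. - (freq k i)\<^sup>2 * cas_mode k x)"
  by (simp add: pdiffs_def pdiff_cas_mode pdiff_scaled_cas_mode power2_eq_square)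

lemma scaled_cas_mode_test_function: "(\<lambda>x. c * cas_mode k x) \<in> test_functions lo hi"
proof -
  have "\<exists>c' l. pdiffs is (\<lambda>x. c * cas_mode k x) = (\<lambda>x. c' * cas_mode l x)" for "is"
  proof (induction "is")
    case (Cons i "is")
    then obtain c' l where "pdiffs is (\<lambda>x. c * cas_mode k x) = (\<lambda>x. c' * cas_mode l x)" by blast
    then have "pdiffs (i # is) (\<lambda>x. c * cas_mode k x) = (\<lambda>x. (c' * freq l i) * cas_mode (- l) x)"
      by (simp add: pdiffs_def pdiff_scaled_cas_mode)
    then show ?case by blast
  qed (auto simp: pdiffs_def)
  moreover have "(\<lambda>x. c * cas_mode l x) differentiable_on UNIV" for c l
    using has_derivative_mult_right[OF cas_mode_has_derivative]
    by (auto simp: differentiable_on_def differentiable_def)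
  moreover have "box_periodic lo hi (\<lambda>x. c * cas_mode k x)"
    using cas_mode_periodic[of k] by (simp add: box_periodic_def)
  ultimately show ?thesis
    unfolding test_functions_def by (simp, metis)
qed

lemma cas_mode_test_function: "cas_mode k \<in> test_functions lo hi"
  using scaled_cas_mode_test_function[of 1 k] by simp

lemma continuous_on_cas_mode: "continuous_on UNIV (cas_mode k)"
  using test_functionsD(4)[OF cas_mode_test_function] .

text \<open>
  This identity serves twice: it reduces orthogonality to the integral of a single mode, and it makes
  the span of the modes an algebra.
\<close>

lemma cas_mode_mult:
  "cas_mode k x * cas_mode l x =
    (cas_mode (k - l) x + cas_mode (l - k) x + cas_mode (k + l) x - cas_mode (- (k + l)) x) / (2 * sqrt vol)"
proof -
  define s where "s = sqrt vol"
  have "s > 0" using vol_pos by (simp add: s_def)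
  then show ?thesis
    unfolding cas_mode_def s_def[symmetric]
    by (simp add: cos_add sin_add cos_diff sin_diff field_simps)
qed

lemma cas_mode_0: "cas_mode 0 x = 1 / sqrt vol"
  by (simp add: cas_mode_def)

lemma integral_cas_mode: "integral\<^sup>L M (cas_mode k) = (if k = 0 then sqrt vol else 0)"
proof (cases "k = 0")
  case True
  then show ?thesis
    using vol_pos by (simp add: cas_mode_0[abs_def] measure_restrict_space real_div_sqrt)
next
  case False
  \<comment> \<open>The mode \<open>k\<close> is then a multiple of a partial derivative of the mode \<open>- k\<close>.\<close>
  then obtain i where i: "freq k i \<noteq> 0" using freq_eq_0_iff by blast
  have "integral\<^sup>L M (\<lambda>x. cas_mode 0 x * pdiff i (cas_mode (- k)) x) = 0"
    using integral_by_parts[OF cas_mode_test_function cas_mode_test_function, of 0 i "- k"]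
    by (simp add: pdiff_cas_mode)
  then show ?thesis
    using i False vol_pos by (simp add: pdiff_cas_mode cas_mode_0)
qed

lemma cas_mode_orthonormal:
  "integral\<^sup>L M (\<lambda>x. cas_mode k x * cas_mode l x) = (if k = l then 1 else 0)"
proof -
  have "- (k + l) = 0 \<longleftrightarrow> k + l = 0" by (rule neg_equal_0_iff_equal)
  then show ?thesis
    unfolding cas_mode_mult using vol_pos
    by (simp add: integral_cas_mode box_integral_continuous continuous_on_cas_mode del: minus_add_distrib)
qed

end

section \<open>The space of square integrable periodic functions\<close>

text \<open>
  Completeness of \<open>L\<^sup>2\<close> for a finite measure, in the form in which the limit is the explicit function
  \<open>\<lambda>x. lim (\<lambda>n. S n x)\<close>; so periodicity of the \<open>S n\<close> passes to it at every point, not only almost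
  everywhere.  The increments \<open>d n\<close> have absolute integrals bounded by a geometric series, so almost every
  sequence of values converges, and Fatou's lemma gives the bound for the limit.
\<close>

lemma L2_limit_of_fast_Cauchy:
  fixes S :: "nat \<Rightarrow> 'a \<Rightarrow> real"
  assumes fin: "finite_measure M"
    and meas[measurable]: "\<And>n. S n \<in> borel_measurable M"
    and int: "\<And>n. integrable M (\<lambda>x. (S n x)\<^sup>2)"
    and Cauchy: "\<And>n m. n \<le> m \<Longrightarrow> integral\<^sup>L M (\<lambda>x. (S m x - S n x)\<^sup>2) \<le> (1 / 4) ^ n"
  defines "f \<equiv> \<lambda>x. lim (\<lambda>n. S n x)"
  shows "integrable M (\<lambda>x. (f x - S n x)\<^sup>2)"
    and "integral\<^sup>L M (\<lambda>x. (f x - S n x)\<^sup>2) \<le> (1 / 4) ^ n"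
proof -
  interpret finite_measure M by fact
  have [measurable]: "f \<in> borel_measurable M"
    unfolding f_def by measurable
  have intd: "integrable M (\<lambda>x. (S m x - S n x)\<^sup>2)" for m n
  proof (rule Bochner_Integration.integrable_bound)
    show "integrable M (\<lambda>x. 2 * (S m x)\<^sup>2 + 2 * (S n x)\<^sup>2)"
      using int by simp
    have "(a - b)\<^sup>2 \<le> 2 * a\<^sup>2 + 2 * b\<^sup>2" for a b :: real
      using zero_le_power2[of "a + b"] by (simp add: power2_eq_square algebra_simps)
    then show "AE x in M. norm ((S m x - S n x)\<^sup>2) \<le> norm (2 * (S m x)\<^sup>2 + 2 * (S n x)\<^sup>2)"
      by simp
  qed simp
  define d where "d n x = S (Suc n) x - S n x" for n x
  have [measurable]: "d n \<in> borel_measurable M" for n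
    unfolding d_def by measurable
  define b where "b n x = ((1 / 2) ^ n + 2 ^ n * (d n x)\<^sup>2) / 2" for n x
  have intb: "integrable M (b n)" for n
    unfolding b_def d_def using intd by simp
  \<comment> \<open>The inequality of the means turns the bound \<open>(1 / 4) ^ n\<close> on the integral of the squared
    increment into one of order \<open>(1 / 2) ^ n\<close> on its absolute integral.\<close>
  have d_le: "\<bar>d n x\<bar> \<le> b n x" for n x
  proof -
    have "0 \<le> (1 / 2) ^ n * (1 - 2 ^ n * \<bar>d n x\<bar>)\<^sup>2" by simp
    also have "\<dots> = (1 / 2) ^ n * (1 - 2 * (2 ^ n * \<bar>d n x\<bar>) + (2 ^ n)\<^sup>2 * (d n x)\<^sup>2)"
      by (simp add: power2_eq_square algebra_simps)
    also have "\<dots> = (1 / 2) ^ n - 2 * \<bar>d n x\<bar> + 2 ^ n * (d n x)\<^sup>2"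
      by (simp add: power2_eq_square algebra_simps power_divide)
    finally show ?thesis by (simp add: b_def)
  qed
  have b_int: "integral\<^sup>L M (b n) \<le> (measure M (space M) + 1) / 2 * (1 / 2) ^ n" for n
  proof -
    have "integral\<^sup>L M (b n) = ((1 / 2) ^ n * measure M (space M) + 2 ^ n * integral\<^sup>L M (\<lambda>x. (d n x)\<^sup>2)) / 2"
      unfolding b_def using intd[of "Suc n" n] by (simp add: d_def mult.commute)
    also have "2 ^ n * integral\<^sup>L M (\<lambda>x. (d n x)\<^sup>2) \<le> 2 ^ n * (1 / 4) ^ n"
      unfolding d_def using Cauchy[of n "Suc n"] by simp
    also have "2 ^ n * (1 / 4) ^ n = (1 / 2 :: real) ^ n"
      by (simp flip: power_mult_distrib)
    finally show ?thesis by (simp add: field_simps)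
  qed
  have "(\<integral>\<^sup>+x. (\<Sum>n. ennreal (b n x)) \<partial>M) = (\<Sum>n. \<integral>\<^sup>+x. ennreal (b n x) \<partial>M)"
    by (rule nn_integral_suminf) (simp add: b_def)
  also have "\<dots> = (\<Sum>n. ennreal (integral\<^sup>L M (b n)))"
    using intb by (subst nn_integral_eq_integral) (auto simp: b_def)
  also have "\<dots> \<le> (\<Sum>n. ennreal ((measure M (space M) + 1) / 2 * (1 / 2) ^ n))"
    using b_int by (intro suminf_le) auto
  also have "\<dots> = ennreal (\<Sum>n. (measure M (space M) + 1) / 2 * (1 / 2) ^ n)"
    by (intro suminf_ennreal2 summable_mult summable_geometric) auto
  also have "\<dots> < \<infinity>" by simp
  finally have "(\<integral>\<^sup>+x. (\<Sum>n. ennreal (b n x)) \<partial>M) \<noteq> \<infinity>" by simp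
  then have "AE x in M. (\<Sum>n. ennreal (b n x)) \<noteq> \<infinity>"
    by (intro nn_integral_PInf_AE) (auto simp: b_def)
  then have lim: "AE x in M. (\<lambda>n. S n x) \<longlonglongrightarrow> f x"
  proof eventually_elim
    fix x assume "(\<Sum>n. ennreal (b n x)) \<noteq> \<infinity>"
    then have "summable (\<lambda>n. b n x)"
      by (intro summable_suminf_not_top) (auto simp: b_def)
    then have "summable (\<lambda>n. d n x)"
      by (rule summable_comparison_test'[where N=0]) (simp add: d_le)
    then have "convergent (\<lambda>n. \<Sum>i<n. d i x)"
      by (simp add: summable_iff_convergent)
    moreover have "(\<Sum>i<n. d i x) = S n x - S 0 x" for n
      unfolding d_def by (rule sum_lessThan_telescope)
    ultimately have "convergent (\<lambda>n. S n x - S 0 x)" by simp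
    then have "convergent (\<lambda>n. S n x)"
      by (simp add: convergent_diff_const_right_iff)
    then show "(\<lambda>n. S n x) \<longlonglongrightarrow> f x"
      by (simp add: convergent_LIMSEQ_iff f_def)
  qed
  have nn: "(\<integral>\<^sup>+x. ennreal ((f x - S n x)\<^sup>2) \<partial>M) \<le> ennreal ((1 / 4) ^ n)" for n
  proof -
    have "AE x in M. ennreal ((f x - S n x)\<^sup>2) = liminf (\<lambda>m. ennreal ((S m x - S n x)\<^sup>2))"
      using lim
    proof eventually_elim
      fix x assume "(\<lambda>n. S n x) \<longlonglongrightarrow> f x"
      then have "(\<lambda>m. ennreal ((S m x - S n x)\<^sup>2)) \<longlonglongrightarrow> ennreal ((f x - S n x)\<^sup>2)"
        by (intro tendsto_ennrealI tendsto_intros)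
      then show "ennreal ((f x - S n x)\<^sup>2) = liminf (\<lambda>m. ennreal ((S m x - S n x)\<^sup>2))"
        by (rule lim_imp_Liminf[OF sequentially_bot, symmetric])
    qed
    then have "(\<integral>\<^sup>+x. ennreal ((f x - S n x)\<^sup>2) \<partial>M) = (\<integral>\<^sup>+x. liminf (\<lambda>m. ennreal ((S m x - S n x)\<^sup>2)) \<partial>M)"
      by (rule nn_integral_cong_AE)
    also have "\<dots> \<le> liminf (\<lambda>m. \<integral>\<^sup>+x. ennreal ((S m x - S n x)\<^sup>2) \<partial>M)"
      by (rule nn_integral_liminf) simp
    also have "\<dots> = liminf (\<lambda>m. ennreal (integral\<^sup>L M (\<lambda>x. (S m x - S n x)\<^sup>2)))"
      by (subst nn_integral_eq_integral[OF intd]) auto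
    also have "\<dots> \<le> liminf (\<lambda>m. ennreal ((1 / 4) ^ n))"
      by (intro Liminf_mono eventually_sequentiallyI[of n] ennreal_leI Cauchy)
    finally show ?thesis by (simp add: Liminf_const)
  qed
  show i: "integrable M (\<lambda>x. (f x - S n x)\<^sup>2)" for n
    using nn[of n] by (intro integrableI_bounded) (auto simp: le_less_trans)
  show "integral\<^sup>L M (\<lambda>x. (f x - S n x)\<^sup>2) \<le> (1 / 4) ^ n"
    using nn[of n] by (subst (asm) nn_integral_eq_integral[OF i]) auto
qed

context torus begin

lemma finite_measure_box: "finite_measure M"
  by (simp add: finite_measure_lebesgue_on)

lemma L2_perD:
  assumes "f \<in> L2_per lo hi"
  shows "box_periodic lo hi f" "f \<in> borel_measurable lebesgue" "f \<in> borel_measurable M"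
    "integrable M (\<lambda>x. (f x)\<^sup>2)"
  using assms by (auto simp: L2_per_def set_integrable_def integrable_restrict_space measurable_restrict_space1)

lemma L2_perI:
  assumes "box_periodic lo hi f" "f \<in> borel_measurable lebesgue" "integrable M (\<lambda>x. (f x)\<^sup>2)"
  shows "f \<in> L2_per lo hi"
  using assms by (auto simp: L2_per_def set_integrable_def integrable_restrict_space)

lemma integrable_mult_L2:
  assumes "f \<in> L2_per lo hi" "g \<in> L2_per lo hi"
  shows "integrable M (\<lambda>x. f x * g x)"
proof (rule Bochner_Integration.integrable_bound)
  show "integrable M (\<lambda>x. (f x)\<^sup>2 + (g x)\<^sup>2)"
    using assms L2_perD(4) by simp
  show "(\<lambda>x. f x * g x) \<in> borel_measurable M"
    using assms L2_perD(3) by measurable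
  have "\<bar>a * b\<bar> \<le> a\<^sup>2 + b\<^sup>2" for a b :: real
    using sum_squares_bound[of a b] sum_squares_bound[of a "- b"] by (simp add: abs_if)
  then show "AE x in M. norm (f x * g x) \<le> norm ((f x)\<^sup>2 + (g x)\<^sup>2)" by simp
qed

lemma L2_per_continuous:
  assumes "box_periodic lo hi f" "continuous_on UNIV f"
  shows "f \<in> L2_per lo hi"
proof (rule L2_perI)
  show "f \<in> borel_measurable lebesgue"
    using assms(2) by (simp add: borel_measurable_continuous_onI measurable_completion)
  show "integrable M (\<lambda>x. (f x)\<^sup>2)"
    by (intro box_integral_continuous continuous_intros assms)
qed fact

lemma L2_per_test_function: "\<eta> \<in> test_functions lo hi \<Longrightarrow> \<eta> \<in> L2_per lo hi"
  using test_functionsD by (intro L2_per_continuous)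

lemma L2_per_cas_mode: "cas_mode k \<in> L2_per lo hi"
  by (intro L2_per_test_function cas_mode_test_function)

lemma L2_per_const: "(\<lambda>x. c) \<in> L2_per lo hi"
  by (intro L2_per_continuous) (auto simp: box_periodic_def)

lemma L2_per_scale:
  assumes "f \<in> L2_per lo hi"
  shows "(\<lambda>x. c * f x) \<in> L2_per lo hi"
  using L2_perD[OF assms] by (intro L2_perI) (auto simp: box_periodic_def power_mult_distrib)

lemma L2_per_add:
  assumes f: "f \<in> L2_per lo hi" and g: "g \<in> L2_per lo hi"
  shows "(\<lambda>x. f x + g x) \<in> L2_per lo hi"
proof (rule L2_perI)
  show "integrable M (\<lambda>x. (f x + g x)\<^sup>2)"
    unfolding power2_sum using integrable_mult_L2[OF f g] L2_perD(4)[OF f] L2_perD(4)[OF g]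
    by (simp add: mult.assoc)
qed (use L2_perD[OF f] L2_perD[OF g] in \<open>auto simp: box_periodic_def\<close>)

lemma L2_per_diff:
  assumes "f \<in> L2_per lo hi" "g \<in> L2_per lo hi"
  shows "(\<lambda>x. f x - g x) \<in> L2_per lo hi"
  using L2_per_add[OF assms(1) L2_per_scale[OF assms(2), of "-1"]] by simp

lemma L2_per_sum:
  assumes "\<And>i. i \<in> A \<Longrightarrow> f i \<in> L2_per lo hi"
  shows "(\<lambda>x. \<Sum>i\<in>A. f i x) \<in> L2_per lo hi"
  using assms
proof (induction A rule: infinite_finite_induct)
  case (insert i A)
  then show ?case using L2_per_add[of "f i" "\<lambda>x. \<Sum>i\<in>A. f i x"] by simp
qed (simp_all add: L2_per_const)

lemma integrable_L2: "f \<in> L2_per lo hi \<Longrightarrow> integrable M f"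
  using integrable_mult_L2[OF _ L2_per_const[of 1], of f] by simp

definition coef :: "(real^'n \<Rightarrow> real) \<Rightarrow> int^'n \<Rightarrow> real" where
  "coef f k = integral\<^sup>L M (\<lambda>x. f x * cas_mode k x)"

lemma coef_add: "f \<in> L2_per lo hi \<Longrightarrow> g \<in> L2_per lo hi \<Longrightarrow> coef (\<lambda>x. f x + g x) k = coef f k + coef g k"
  and coef_diff: "f \<in> L2_per lo hi \<Longrightarrow> g \<in> L2_per lo hi \<Longrightarrow> coef (\<lambda>x. f x - g x) k = coef f k - coef g k"
  and coef_scale: "coef (\<lambda>x. c * f x) k = c * coef f k"
  by (simp_all add: coef_def integrable_mult_L2 L2_per_cas_mode ring_distribs mult.assoc)

lemma coef_sum:
  assumes "\<And>i. i \<in> A \<Longrightarrow> f i \<in> L2_per lo hi"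
  shows "coef (\<lambda>x. \<Sum>i\<in>A. f i x) k = (\<Sum>i\<in>A. coef (f i) k)"
  using assms by (simp add: coef_def integrable_mult_L2 L2_per_cas_mode sum_distrib_right)

lemma coef_partial_sum:
  assumes "finite A"
  shows "coef (\<lambda>x. \<Sum>k\<in>A. c k * cas_mode k x) l = (if l \<in> A then c l else 0)"
proof -
  have "coef (\<lambda>x. \<Sum>k\<in>A. c k * cas_mode k x) l = (\<Sum>k\<in>A. c k * coef (cas_mode k) l)"
    by (subst coef_sum) (auto simp: coef_scale L2_per_scale L2_per_cas_mode)
  also have "\<dots> = (\<Sum>k\<in>A. if k = l then c l else 0)"
    by (intro sum.cong) (auto simp: coef_def cas_mode_orthonormal)
  finally show ?thesis using assms by simp
qed

lemma integral_mult_partial_sum: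
  assumes "f \<in> L2_per lo hi"
  shows "integral\<^sup>L M (\<lambda>x. f x * (\<Sum>k\<in>A. c k * cas_mode k x)) = (\<Sum>k\<in>A. c k * coef f k)"
proof -
  have "integral\<^sup>L M (\<lambda>x. f x * (\<Sum>k\<in>A. c k * cas_mode k x))
      = integral\<^sup>L M (\<lambda>x. \<Sum>k\<in>A. c k * (f x * cas_mode k x))"
    by (simp add: sum_distrib_left mult_ac)
  then show ?thesis
    using assms by (simp add: coef_def integrable_mult_L2 L2_per_cas_mode)
qed

lemma L2_per_partial_sum: "(\<lambda>x. \<Sum>k\<in>A. c k * cas_mode k x) \<in> L2_per lo hi"
  by (intro L2_per_sum L2_per_scale L2_per_cas_mode)

lemma integral_partial_sum_square:
  assumes "finite A"
  shows "integral\<^sup>L M (\<lambda>x. (\<Sum>k\<in>A. c k * cas_mode k x)\<^sup>2) = (\<Sum>k\<in>A. (c k)\<^sup>2)"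
  using integral_mult_partial_sum[OF L2_per_partial_sum, of c A c A] coef_partial_sum[OF assms, of c]
  by (simp add: power2_eq_square)

text \<open>
  Pythagoras: a partial sum of the Fourier series is the orthogonal projection of \<open>f\<close>.
\<close>

lemma integral_square_diff_partial_sum:
  assumes "f \<in> L2_per lo hi" and "finite A" and "\<And>k. k \<in> A \<Longrightarrow> coef f k = c k"
  shows "integral\<^sup>L M (\<lambda>x. (f x - (\<Sum>k\<in>A. c k * cas_mode k x))\<^sup>2)
    = integral\<^sup>L M (\<lambda>x. (f x)\<^sup>2) - (\<Sum>k\<in>A. (c k)\<^sup>2)"
proof -
  let ?S = "\<lambda>x. \<Sum>k\<in>A. c k * cas_mode k x"
  have "integral\<^sup>L M (\<lambda>x. (f x - ?S x)\<^sup>2)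
      = integral\<^sup>L M (\<lambda>x. (f x)\<^sup>2) + integral\<^sup>L M (\<lambda>x. (?S x)\<^sup>2) - 2 * integral\<^sup>L M (\<lambda>x. f x * ?S x)"
    using assms L2_per_partial_sum[where A=A and c=c]
    by (simp add: power2_diff L2_perD(4) integrable_mult_L2 mult.assoc)
  also have "integral\<^sup>L M (\<lambda>x. f x * ?S x) = (\<Sum>k\<in>A. (c k)\<^sup>2)"
    using assms by (simp add: integral_mult_partial_sum power2_eq_square)
  also have "integral\<^sup>L M (\<lambda>x. (?S x)\<^sup>2) = (\<Sum>k\<in>A. (c k)\<^sup>2)"
    using assms by (simp add: integral_partial_sum_square)
  finally show ?thesis by simp
qed

lemma Bessel_inequality:
  assumes "f \<in> L2_per lo hi" and "finite A"
  shows "(\<Sum>k\<in>A. (coef f k)\<^sup>2) \<le> integral\<^sup>L M (\<lambda>x. (f x)\<^sup>2)"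
proof -
  have "0 \<le> integral\<^sup>L M (\<lambda>x. (f x - (\<Sum>k\<in>A. coef f k * cas_mode k x))\<^sup>2)"
    by simp
  then show ?thesis
    using assms by (simp add: integral_square_diff_partial_sum)
qed

end

section \<open>Completeness of the trigonometric system\<close>

context torus begin

inductive_set trig_polys :: "(real^'n \<Rightarrow> real) set" where
  mode: "cas_mode k \<in> trig_polys"
| add: "p \<in> trig_polys \<Longrightarrow> q \<in> trig_polys \<Longrightarrow> (\<lambda>x. p x + q x) \<in> trig_polys"
| scale: "p \<in> trig_polys \<Longrightarrow> (\<lambda>x. c * p x) \<in> trig_polys"

lemma trig_polys_diff: "p \<in> trig_polys \<Longrightarrow> q \<in> trig_polys \<Longrightarrow> (\<lambda>x. p x - q x) \<in> trig_polys"
  using trig_polys.add[OF _ trig_polys.scale[of q "-1"], of p] by simp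

lemma trig_polys_const: "(\<lambda>x. c) \<in> trig_polys"
  using trig_polys.scale[OF trig_polys.mode[of 0], of "c * sqrt vol"] vol_pos
  by (simp add: cas_mode_0[abs_def])

lemma trig_polys_mult_mode:
  assumes "p \<in> trig_polys"
  shows "(\<lambda>x. cas_mode k x * p x) \<in> trig_polys"
  using assms
proof induction
  case (mode l)
  have "(\<lambda>x. (1 / (2 * sqrt vol)) * (((cas_mode (k - l) x + cas_mode (l - k) x) + cas_mode (k + l) x)
      - cas_mode (- (k + l)) x)) \<in> trig_polys"
    by (intro trig_polys.intros trig_polys_diff)
  then show ?case
    by (simp only: cas_mode_mult times_divide_eq_left mult_1)
next
  case (add p q)
  then show ?case using trig_polys.add by (simp add: distrib_left)
next
  case (scale p c)
  then show ?case using trig_polys.scale by (simp add: mult.left_commute)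
qed

lemma trig_polys_mult:
  assumes "p \<in> trig_polys" "q \<in> trig_polys"
  shows "(\<lambda>x. p x * q x) \<in> trig_polys"
  using assms(1)
proof induction
  case (mode l)
  then show ?case using trig_polys_mult_mode assms(2) by blast
next
  case (add p1 p2)
  then show ?case using trig_polys.add by (simp add: distrib_right)
next
  case (scale p c)
  then show ?case using trig_polys.scale by (simp add: mult.assoc)
qed

lemma trig_polys_L2: "p \<in> trig_polys \<Longrightarrow> p \<in> L2_per lo hi"
  by (induction rule: trig_polys.induct) (auto intro: L2_per_cas_mode L2_per_add L2_per_scale)

lemma trig_polys_cos_sin:
  "(\<lambda>x. cos (phase k x)) \<in> trig_polys" "(\<lambda>x. sin (phase k x)) \<in> trig_polys"
proof -
  have "(\<lambda>x. (sqrt vol / 2) * (cas_mode k x + cas_mode (- k) x)) \<in> trig_polys"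
    "(\<lambda>x. (sqrt vol / 2) * (cas_mode k x - cas_mode (- k) x)) \<in> trig_polys"
    by (intro trig_polys.intros trig_polys_diff)+
  moreover have "sqrt vol \<noteq> 0" using vol_pos by simp
  ultimately show "(\<lambda>x. cos (phase k x)) \<in> trig_polys" "(\<lambda>x. sin (phase k x)) \<in> trig_polys"
    by (simp_all add: cas_mode_def field_simps)
qed

lemma integral_mult_trig_poly_eq_0:
  assumes f: "f \<in> L2_per lo hi" and zero: "\<And>k. coef f k = 0" and "p \<in> trig_polys"
  shows "integral\<^sup>L M (\<lambda>x. f x * p x) = 0"
  using assms(3)
proof induction
  case (mode k)
  then show ?case using zero by (simp add: coef_def)
next
  case (add p q)
  then show ?case
    using integrable_mult_L2[OF f trig_polys_L2] by (simp add: distrib_left)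
next
  case (scale p c)
  then show ?case by (simp add: mult.left_commute)
qed

text \<open>
  Wrapping each coordinate around a circle identifies opposite faces of the box.  The
  trigonometric polynomials do not separate points of opposite faces, so the Stone--Weierstrass
  theorem is applied on the image of the box under this map.
\<close>

definition to_circles :: "real^'n \<Rightarrow> complex^'n" where
  "to_circles x = (\<chi> i. cis (phase (axis i 1) x))"

lemma phase_axis_index: "phase (axis i 1) x = 2 * pi * x $ i / (hi $ i - lo $ i)"
  by (simp add: phase_def freq_def axis_def if_distrib[of of_int] if_distrib[of "\<lambda>y. 2 * pi * y"]
      if_distrib[of "\<lambda>y. y / _"] if_distrib[of "\<lambda>y. y * _"] cong: if_cong)

lemma continuous_on_to_circles: "continuous_on S to_circles"
  unfolding to_circles_def phase_def
  by (intro continuous_intros)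

lemma to_circles_eq_imp_on_faces:
  assumes "x \<in> cbox lo hi" "y \<in> cbox lo hi" "to_circles x = to_circles y" "x \<noteq> y"
  shows "\<exists>i. {x $ i, y $ i} = {lo $ i, hi $ i}"
proof -
  obtain i where i: "x $ i \<noteq> y $ i" using assms(4) by (auto simp: vec_eq_iff)
  define l where "l = hi $ i - lo $ i"
  have l: "l > 0" using lo_less_hi by (simp add: l_def)
  have "cis (phase (axis i 1) x) = cis (phase (axis i 1) y)"
    using assms(3) by (auto simp: to_circles_def vec_eq_iff)
  then have "sin (phase (axis i 1) y) = sin (phase (axis i 1) x) \<and>
      cos (phase (axis i 1) y) = cos (phase (axis i 1) x)"
    by (metis cis.simps)
  then obtain n :: int where "phase (axis i 1) y = phase (axis i 1) x + 2 * pi * n"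
    using sin_cos_eq_iff by blast
  then have "2 * pi * (y $ i) = 2 * pi * (x $ i + of_int n * l)"
    using l unfolding phase_axis_index l_def[symmetric] by (simp add: field_simps)
  then have n: "y $ i = x $ i + of_int n * l" by simp
  have box: "lo $ i \<le> x $ i" "x $ i \<le> hi $ i" "lo $ i \<le> y $ i" "y $ i \<le> hi $ i"
    using assms(1,2) by (auto simp: mem_box_cart)
  have "\<bar>of_int n * l\<bar> \<le> 1 * l" using n box by (auto simp: l_def)
  then have "\<bar>of_int n\<bar> \<le> (1::real)" using l by (simp add: abs_mult)
  then have "n = -1 \<or> n = 0 \<or> n = 1" by linarith
  with n i box have "x $ i = lo $ i \<and> y $ i = hi $ i \<or> x $ i = hi $ i \<and> y $ i = lo $ i"
    by (auto simp: l_def)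
  then show ?thesis by (intro exI[of _ i]) auto
qed

text \<open>
  A function that vanishes on all faces factors through the wrapping map, by
  \<open>to_circles_eq_imp_on_faces\<close>.  The factor \<open>c'\<close> is continuous since the preimage of a closed set under
  \<open>c'\<close> is the image of a compact set.
\<close>

lemma trig_poly_approx:
  assumes cont: "continuous_on (cbox lo hi) c"
    and faces: "\<And>x i. x \<in> cbox lo hi \<Longrightarrow> x $ i = lo $ i \<or> x $ i = hi $ i \<Longrightarrow> c x = 0"
    and "e > 0"
  shows "\<exists>p\<in>trig_polys. \<forall>x\<in>cbox lo hi. \<bar>c x - p x\<bar> < e"
proof -
  define K where "K = to_circles ` cbox lo hi"
  define R where "R = {g :: complex^'n \<Rightarrow> real. continuous_on K g \<and>
      (\<exists>p\<in>trig_polys. \<forall>x\<in>cbox lo hi. g (to_circles x) = p x)}"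
  have K: "compact K"
    unfolding K_def by (intro compact_continuous_image continuous_on_to_circles compact_cbox)
  have R_I: "g \<in> R" if "continuous_on K g" "p \<in> trig_polys" "\<And>x. g (to_circles x) = p x" for g p
    unfolding R_def using that by blast
  have coord: "(\<lambda>z. Re (z $ i)) \<in> R" "(\<lambda>z. Im (z $ i)) \<in> R" for i
    by (rule R_I[OF _ trig_polys_cos_sin(1)[of "axis i 1"]],
        intro continuous_intros, simp add: to_circles_def)
       (rule R_I[OF _ trig_polys_cos_sin(2)[of "axis i 1"]],
        intro continuous_intros, simp add: to_circles_def)
  interpret R: function_ring_on R K
  proof
    show "compact K" by (rule K)
    show "continuous_on K g" if "g \<in> R" for g using that by (simp add: R_def)
    show "(\<lambda>_. c) \<in> R" for c :: real
      unfolding R_def using trig_polys_const[of c] by auto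
    show "(\<lambda>x. g x + h x) \<in> R" if "g \<in> R" "h \<in> R" for g h
    proof -
      from that obtain p q where "p \<in> trig_polys" "q \<in> trig_polys"
        "\<forall>x\<in>cbox lo hi. g (to_circles x) = p x" "\<forall>x\<in>cbox lo hi. h (to_circles x) = q x"
        unfolding R_def by auto
      then have "\<exists>p\<in>trig_polys. \<forall>x\<in>cbox lo hi. g (to_circles x) + h (to_circles x) = p x"
        using trig_polys.add by (intro bexI[of _ "\<lambda>x. p x + q x"]) auto
      then show ?thesis
        using that by (auto simp: R_def intro: continuous_on_add)
    qed
    show "(\<lambda>x. g x * h x) \<in> R" if "g \<in> R" "h \<in> R" for g h
    proof -
      from that obtain p q where "p \<in> trig_polys" "q \<in> trig_polys"
        "\<forall>x\<in>cbox lo hi. g (to_circles x) = p x" "\<forall>x\<in>cbox lo hi. h (to_circles x) = q x"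
        unfolding R_def by auto
      then have "\<exists>p\<in>trig_polys. \<forall>x\<in>cbox lo hi. g (to_circles x) * h (to_circles x) = p x"
        using trig_polys_mult by (intro bexI[of _ "\<lambda>x. p x * q x"]) auto
      then show ?thesis
        using that by (auto simp: R_def intro: continuous_on_mult)
    qed
    show "\<exists>g\<in>R. g z \<noteq> g w" if "z \<noteq> w" for z w :: "complex^'n"
    proof -
      from that obtain i where "z $ i \<noteq> w $ i" by (auto simp: vec_eq_iff)
      then have "Re (z $ i) \<noteq> Re (w $ i) \<or> Im (z $ i) \<noteq> Im (w $ i)"
        by (simp add: complex_eq_iff)
      then show ?thesis
        using coord[of i] by (metis (no_types, lifting))
    qed
  qed
  define c' where "c' z = c (SOME x. x \<in> cbox lo hi \<and> to_circles x = z)" for z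
  have c': "c' (to_circles x) = c x" if x: "x \<in> cbox lo hi" for x
  proof -
    define y where "y = (SOME y. y \<in> cbox lo hi \<and> to_circles y = to_circles x)"
    have y: "y \<in> cbox lo hi \<and> to_circles y = to_circles x"
      unfolding y_def by (rule someI[of _ x]) (use x in auto)
    have "c y = c x"
    proof (cases "x = y")
      case False
      then obtain i where "{x $ i, y $ i} = {lo $ i, hi $ i}"
        using to_circles_eq_imp_on_faces[of x y] x y by auto
      then have "x $ i = lo $ i \<or> x $ i = hi $ i" "y $ i = lo $ i \<or> y $ i = hi $ i"
        by (auto simp: doubleton_eq_iff)
      then show ?thesis using faces x y by metis
    qed simp
    then show ?thesis by (simp add: c'_def y_def)
  qed
  have "continuous_on K c'"
  proof (subst continuous_on_closed_vimage)
    show "closed K" using K compact_imp_closed by blast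
    show "\<forall>B. closed B \<longrightarrow> closed (c' -` B \<inter> K)"
    proof (intro allI impI)
      fix B :: "real set" assume B: "closed B"
      have "c' -` B \<inter> K = to_circles ` (c -` B \<inter> cbox lo hi)"
        unfolding K_def using c' by auto
      moreover have "closed (c -` B \<inter> cbox lo hi)"
        using cont B continuous_on_closed_vimage[of "cbox lo hi" c] by auto
      then have "compact (c -` B \<inter> cbox lo hi)"
        using compact_cbox[of lo hi] by (metis compact_Int_closed inf.right_idem inf_commute)
      ultimately show "closed (c' -` B \<inter> K)"
        using compact_continuous_image[OF continuous_on_to_circles] compact_imp_closed by metis
    qed
  qed
  from R.Stone_Weierstrass_basic[OF this \<open>e > 0\<close>]
  obtain g where g: "g \<in> R" "\<forall>z\<in>K. \<bar>c' z - g z\<bar> < e" by blast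
  then obtain p where p: "p \<in> trig_polys" "\<forall>x\<in>cbox lo hi. g (to_circles x) = p x"
    unfolding R_def by blast
  have "\<bar>c x - p x\<bar> < e" if "x \<in> cbox lo hi" for x
    using g(2) p(2) c'[OF that] that by (force simp: K_def)
  then show ?thesis using p(1) by blast
qed

lemma integral_mult_continuous_eq_0:
  assumes f: "f \<in> L2_per lo hi" and zero: "\<And>k. coef f k = 0"
    and cont: "continuous_on UNIV c"
    and faces: "\<And>x i. x \<in> cbox lo hi \<Longrightarrow> x $ i = lo $ i \<or> x $ i = hi $ i \<Longrightarrow> c x = 0"
  shows "integral\<^sup>L M (\<lambda>x. f x * c x) = 0"
proof (rule ccontr)
  assume ne: "integral\<^sup>L M (\<lambda>x. f x * c x) \<noteq> 0"
  define A where "A = integral\<^sup>L M (\<lambda>x. \<bar>f x\<bar>)"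
  have A: "A \<ge> 0" by (simp add: A_def)
  define e where "e = \<bar>integral\<^sup>L M (\<lambda>x. f x * c x)\<bar> / (A + 1)"
  have e: "e > 0" using ne A by (simp add: e_def)
  \<comment> \<open>The choice of \<open>e\<close> makes the approximation error smaller than the integral itself.\<close>
  obtain p where p: "p \<in> trig_polys" "\<forall>x\<in>cbox lo hi. \<bar>c x - p x\<bar> < e"
    using trig_poly_approx[OF continuous_on_subset[OF cont subset_UNIV] _ e] faces by blast
  have ifp: "integrable M (\<lambda>x. f x * p x)"
    using integrable_mult_L2[OF f trig_polys_L2[OF p(1)]] .
  have [measurable]: "c \<in> borel_measurable M" "f \<in> borel_measurable M"
    using box_integral_continuous(1)[OF cont] L2_perD(3)[OF f] by auto
  have [measurable]: "p \<in> borel_measurable M"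
    using L2_perD(3)[OF trig_polys_L2[OF p(1)]] .
  have le: "AE x in M. norm (f x * (c x - p x)) \<le> e * \<bar>f x\<bar>"
  proof (rule AE_I2)
    fix x assume "x \<in> space M"
    then have "\<bar>c x - p x\<bar> \<le> e" using p(2) by (auto intro: less_imp_le)
    then show "norm (f x * (c x - p x)) \<le> e * \<bar>f x\<bar>"
      using mult_left_mono[of "\<bar>c x - p x\<bar>" e "\<bar>f x\<bar>"] by (simp add: abs_mult mult.commute)
  qed
  have ifcp: "integrable M (\<lambda>x. f x * (c x - p x))"
    by (rule Bochner_Integration.integrable_bound[of _ "\<lambda>x. e * \<bar>f x\<bar>"])
       (use integrable_L2[OF f] le e in auto)
  have "integral\<^sup>L M (\<lambda>x. f x * c x) = integral\<^sup>L M (\<lambda>x. f x * (c x - p x) + f x * p x)"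
    by (simp add: algebra_simps)
  also have "\<dots> = integral\<^sup>L M (\<lambda>x. f x * (c x - p x))"
    using integral_mult_trig_poly_eq_0[OF f zero p(1)] ifp ifcp by simp
  finally have "\<bar>integral\<^sup>L M (\<lambda>x. f x * c x)\<bar> \<le> integral\<^sup>L M (\<lambda>x. norm (f x * (c x - p x)))"
    using integral_norm_bound[of M "\<lambda>x. f x * (c x - p x)"] by simp
  also have "\<dots> \<le> integral\<^sup>L M (\<lambda>x. e * \<bar>f x\<bar>)"
    using ifcp le integrable_L2[OF f] by (intro integral_mono_AE) auto
  also have "\<dots> = e * A" by (simp add: A_def)
  also have "\<dots> < e * (A + 1)" using e by simp
  also have "\<dots> = \<bar>integral\<^sup>L M (\<lambda>x. f x * c x)\<bar>" using A by (simp add: e_def)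
  finally show False by simp
qed

text \<open>
  The measurable function \<open>f\<close> is almost everywhere a limit of continuous functions.  Truncated to
  \<open>[-1, 1]\<close> and multiplied by bumps that vanish on the faces, these become bounded functions orthogonal
  to \<open>f\<close>, and they converge to the truncation of \<open>f\<close>.  In the limit, \<open>f\<close> is orthogonal to its own truncation,
  and the product of the two is positive wherever \<open>f\<close> is not zero.
\<close>

lemma AE_eq_0_if_coef_eq_0:
  assumes f: "f \<in> L2_per lo hi" and zero: "\<And>k. coef f k = 0"
  shows "AE x in M. f x = 0"
proof -
  have "f measurable_on UNIV"
    using L2_perD(2)[OF f] by (intro lebesgue_measurable_imp_measurable_on) (auto simp: lebesgue_on_UNIV_eq)
  then obtain N g where N: "negligible N" and g: "\<And>n. continuous_on UNIV (g n)"
    and lim: "\<And>x. x \<notin> N \<Longrightarrow> (\<lambda>n. g n x) \<longlonglongrightarrow> f x"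
    unfolding measurable_on_def by auto
  define clamp where "clamp t = max (-1) (min 1 t)" for t :: real
  define bump where "bump x = (\<Prod>i\<in>UNIV. (x $ i - lo $ i) * (hi $ i - x $ i))" for x
  define c where "c n x = clamp (g n x) * min 1 (real n * bump x)" for n x
  have bump0: "bump x = 0" if "x $ i = lo $ i \<or> x $ i = hi $ i" for x i
    unfolding bump_def by (rule prod_zero[OF _ bexI[of _ i]]) (use that in auto)
  have zero_c: "integral\<^sup>L M (\<lambda>x. f x * c n x) = 0" for n
  proof (rule integral_mult_continuous_eq_0[OF f zero])
    show "continuous_on UNIV (c n)"
      unfolding c_def clamp_def bump_def
      by (intro continuous_intros g)
    show "c n x = 0" if "x $ i = lo $ i \<or> x $ i = hi $ i" for x i
      using bump0[OF that] by (simp add: c_def)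
  qed
  have [measurable]: "f \<in> borel_measurable M" using L2_perD(3)[OF f] .
  have [measurable]: "c n \<in> borel_measurable M" for n
  proof -
    have "continuous_on UNIV (c n)"
      unfolding c_def clamp_def bump_def by (intro continuous_intros g)
    then show ?thesis using box_integral_continuous(1) by blast
  qed
  have [measurable]: "clamp \<in> borel_measurable borel"
    unfolding clamp_def by measurable
  have "(\<lambda>n. integral\<^sup>L M (\<lambda>x. f x * c n x)) \<longlonglongrightarrow> integral\<^sup>L M (\<lambda>x. f x * clamp (f x))"
  proof (rule integral_dominated_convergence[where w="\<lambda>x. \<bar>f x\<bar>"])
    have "negligible (cbox lo hi - box lo hi)"
      using negligible_frontier_interval by auto
    then have "negligible (N \<union> (cbox lo hi - box lo hi))"
      using N by (simp add: negligible_Un)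
    then have ae: "AE x in lebesgue. x \<notin> N \<union> (cbox lo hi - box lo hi)"
      using negligible_iff_null_sets AE_not_in by blast
    have ae: "AE x in M. x \<notin> N \<union> (cbox lo hi - box lo hi)"
      by (subst AE_restrict_space_iff) (use ae in auto)
    then show "AE x in M. (\<lambda>n. f x * c n x) \<longlonglongrightarrow> f x * clamp (f x)"
      using AE_space
    proof eventually_elim
      fix x assume x: "x \<notin> N \<union> (cbox lo hi - box lo hi)" "x \<in> space M"
      then have "x \<in> box lo hi" by simp
      then have "bump x > 0"
        unfolding bump_def by (intro prod_pos) (auto simp: mem_box_cart)
      then obtain m where m: "1 < real m * bump x"
        using reals_Archimedean3 by blast
      have "min 1 (real n * bump x) = 1" if "n \<ge> m" for n
      proof -
        have "real m * bump x \<le> real n * bump x"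
          using that \<open>bump x > 0\<close> by (intro mult_right_mono) auto
        then show ?thesis using m by simp
      qed
      then have "\<forall>\<^sub>F n in sequentially. min 1 (real n * bump x) = 1"
        by (rule eventually_sequentiallyI)
      then have 1: "(\<lambda>n. min 1 (real n * bump x)) \<longlonglongrightarrow> 1"
        by (rule tendsto_eventually)
      have 2: "(\<lambda>n. clamp (g n x)) \<longlonglongrightarrow> clamp (f x)"
        unfolding clamp_def using x lim[of x] by (intro tendsto_intros) auto
      show "(\<lambda>n. f x * c n x) \<longlonglongrightarrow> f x * clamp (f x)"
        using tendsto_mult[OF tendsto_const tendsto_mult[OF 2 1]] by (simp add: c_def)
    qed
    show "AE x in M. norm (f x * c n x) \<le> \<bar>f x\<bar>" for n
    proof (rule AE_I2)
      fix x assume "x \<in> space M"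
      then have "bump x \<ge> 0"
        unfolding bump_def by (intro prod_nonneg) (auto simp: mem_box_cart)
      then have "\<bar>min 1 (real n * bump x)\<bar> \<le> 1" by (simp add: min_def)
      moreover have "\<bar>clamp (g n x)\<bar> \<le> 1" by (auto simp: clamp_def)
      ultimately have "\<bar>c n x\<bar> \<le> 1"
        unfolding c_def by (simp add: abs_mult mult_le_one)
      then show "norm (f x * c n x) \<le> \<bar>f x\<bar>"
        using mult_left_mono[of "\<bar>c n x\<bar>" 1 "\<bar>f x\<bar>"] by (simp add: abs_mult)
    qed
  qed (use integrable_L2[OF f] in simp_all)
  then have int0: "integral\<^sup>L M (\<lambda>x. f x * clamp (f x)) = 0"
    unfolding zero_c by (simp add: LIMSEQ_const_iff)
  have nn: "0 \<le> t * clamp t" for t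
    by (cases "0 \<le> t") (auto simp: clamp_def zero_le_mult_iff)
  have "integrable M (\<lambda>x. f x * clamp (f x))"
  proof (rule Bochner_Integration.integrable_bound[of _ "\<lambda>x. \<bar>f x\<bar>"])
    have "\<bar>clamp t\<bar> \<le> 1" for t by (auto simp: clamp_def)
    then show "AE x in M. norm (f x * clamp (f x)) \<le> norm \<bar>f x\<bar>"
      using mult_left_mono[of "\<bar>clamp (f x)\<bar>" 1 "\<bar>f x\<bar>" for x] by (simp add: abs_mult)
  qed (use integrable_L2[OF f] in simp_all)
  then have "AE x in M. f x * clamp (f x) = 0"
    using int0 nn by (subst (asm) integral_nonneg_eq_0_iff_AE) auto
  then show ?thesis
    by eventually_elim (auto simp: clamp_def max_def min_def split: if_splits)
qed

end

section \<open>The theorems of Riesz--Fischer and Parseval\<close>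

context torus begin

text \<open>
  The partial sums over suitable finite sets \<open>A n\<close> of indices, outside of which the squares sum to at most
  \<open>(1 / 4) ^ n\<close>, form a fast Cauchy sequence in \<open>L\<^sup>2\<close>; its limit has the prescribed coefficients.
\<close>

theorem Riesz_Fischer:
  fixes c :: "int^'n \<Rightarrow> real"
  assumes c: "(\<lambda>k. (c k)\<^sup>2) summable_on UNIV"
  obtains f where "f \<in> L2_per lo hi" "\<And>k. coef f k = c k"
    "integral\<^sup>L M (\<lambda>x. (f x)\<^sup>2) \<le> (\<Sum>\<^sub>\<infinity>k. (c k)\<^sup>2)"
proof -
  define s where "s = (\<Sum>\<^sub>\<infinity>k. (c k)\<^sup>2)"
  have hs: "((\<lambda>k. (c k)\<^sup>2) has_sum s) UNIV"
    using c by (simp add: s_def)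
  have fin_le: "(\<Sum>k\<in>A. (c k)\<^sup>2) \<le> s" if "finite A" for A
    unfolding s_def using c that by (intro finite_sum_le_infsum) auto
  have "\<exists>B. finite B \<and> s - (\<Sum>k\<in>B. (c k)\<^sup>2) \<le> (1 / 4) ^ n" for n :: nat
  proof -
    obtain B where "finite B" "dist (\<Sum>k\<in>B. (c k)\<^sup>2) s \<le> (1 / 4) ^ n"
      using has_sum_finite_approximation[OF hs, of "(1 / 4) ^ n"] by auto
    then show ?thesis by (intro exI[of _ B]) (auto simp: dist_real_def)
  qed
  then obtain B where B: "\<And>n. finite (B n)" "\<And>n::nat. s - (\<Sum>k\<in>B n. (c k)\<^sup>2) \<le> (1 / 4) ^ n"
    by metis
  define A where "A n = (\<Union>j\<le>n. B j)" for n
  have A: "finite (A n)" "m \<le> n \<Longrightarrow> A m \<subseteq> A n" for m n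
    using B(1) by (auto simp: A_def dest: order_trans)
  have sA: "s - (\<Sum>k\<in>A n. (c k)\<^sup>2) \<le> (1 / 4) ^ n" for n
  proof -
    have "(\<Sum>k\<in>B n. (c k)\<^sup>2) \<le> (\<Sum>k\<in>A n. (c k)\<^sup>2)"
      using A(1) by (intro sum_mono2) (auto simp: A_def)
    then show ?thesis using B(2)[of n] by linarith
  qed
  define S where "S n = (\<lambda>x. \<Sum>k\<in>A n. c k * cas_mode k x)" for n
  have SL2: "S n \<in> L2_per lo hi" for n
    unfolding S_def by (rule L2_per_partial_sum)
  have Cauchy: "integral\<^sup>L M (\<lambda>x. (S m x - S n x)\<^sup>2) \<le> (1 / 4) ^ n" if "n \<le> m" for n m
  proof -
    have "coef (S m) k = c k" if "k \<in> A n" for k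
      using that A(2)[OF \<open>n \<le> m\<close>] A(1) unfolding S_def by (subst coef_partial_sum) auto
    then have "integral\<^sup>L M (\<lambda>x. (S m x - S n x)\<^sup>2)
        = integral\<^sup>L M (\<lambda>x. (S m x)\<^sup>2) - (\<Sum>k\<in>A n. (c k)\<^sup>2)"
      unfolding S_def[of n] by (rule integral_square_diff_partial_sum[OF SL2 A(1)])
    also have "integral\<^sup>L M (\<lambda>x. (S m x)\<^sup>2) = (\<Sum>k\<in>A m. (c k)\<^sup>2)"
      unfolding S_def by (rule integral_partial_sum_square[OF A(1)])
    finally show ?thesis using fin_le[OF A(1)[of m]] sA[of n] by linarith
  qed
  define f where "f x = lim (\<lambda>n. S n x)" for x
  have limit: "integrable M (\<lambda>x. (f x - S n x)\<^sup>2)"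
    "integral\<^sup>L M (\<lambda>x. (f x - S n x)\<^sup>2) \<le> (1 / 4) ^ n" for n
    unfolding f_def
    by (rule L2_limit_of_fast_Cauchy[OF finite_measure_box L2_perD(3)[OF SL2] L2_perD(4)[OF SL2] Cauchy], assumption)+
  have [measurable]: "S n \<in> borel_measurable lebesgue" for n
    using L2_perD(2)[OF SL2] .
  have fL2: "f \<in> L2_per lo hi"
  proof -
    have "(\<lambda>x. f x - S 0 x) \<in> L2_per lo hi"
    proof (rule L2_perI)
      show "box_periodic lo hi (\<lambda>x. f x - S 0 x)"
        using L2_perD(1)[OF SL2] by (simp add: box_periodic_def f_def)
      show "(\<lambda>x. f x - S 0 x) \<in> borel_measurable lebesgue"
        unfolding f_def by measurable
    qed (rule limit(1))
    from L2_per_add[OF this SL2[of 0]] show ?thesis by simp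
  qed
  have coef_f: "coef f k = c k" for k
  proof -
    have "\<bar>coef f k - c k\<bar> \<le> 2 * (1 / 2) ^ n" for n
    proof -
      define g where "g = (\<lambda>x. f x - S n x)"
      have gL2: "g \<in> L2_per lo hi" unfolding g_def by (intro L2_per_diff fL2 SL2)
      have "\<bar>coef f k - coef (S n) k\<bar> = \<bar>coef g k\<bar>"
        unfolding g_def by (simp add: coef_diff fL2 SL2)
      also have "\<dots> \<le> (1 / 2) ^ n"
      proof -
        \<comment> \<open>Bessel's inequality for a single mode replaces the Cauchy--Schwarz inequality.\<close>
        have "(coef g k)\<^sup>2 \<le> integral\<^sup>L M (\<lambda>x. (g x)\<^sup>2)"
          using Bessel_inequality[OF gL2, of "{k}"] by simp
        also have "\<dots> \<le> (1 / 4) ^ n" unfolding g_def by (rule limit(2))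
        also have "\<dots> = ((1 / 2) ^ n)\<^sup>2"
          by (simp add: power2_eq_square flip: power_mult_distrib)
        finally show ?thesis using abs_le_square_iff[of "coef g k" "(1 / 2) ^ n"] by simp
      qed
      finally have 1: "\<bar>coef f k - coef (S n) k\<bar> \<le> (1 / 2) ^ n" .
      have "\<bar>coef (S n) k - c k\<bar> \<le> (1 / 2) ^ n"
      proof (cases "k \<in> A n")
        case True
        then show ?thesis unfolding S_def by (simp add: coef_partial_sum A(1))
      next
        case False
        have "(c k)\<^sup>2 + (\<Sum>k\<in>A n. (c k)\<^sup>2) \<le> s"
          using fin_le[of "insert k (A n)"] A(1) False by simp
        then have "(c k)\<^sup>2 \<le> (1 / 4) ^ n" using sA[of n] by linarith
        also have "\<dots> = ((1 / 2) ^ n)\<^sup>2"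
          by (simp add: power2_eq_square flip: power_mult_distrib)
        finally have "\<bar>c k\<bar> \<le> (1 / 2) ^ n"
          using abs_le_square_iff[of "c k" "(1 / 2) ^ n"] by simp
        then show ?thesis using False unfolding S_def by (simp add: coef_partial_sum A(1))
      qed
      with 1 show ?thesis by linarith
    qed
    moreover have "(\<lambda>n. 2 * (1 / 2) ^ n :: real) \<longlonglongrightarrow> 2 * 0"
      by (intro tendsto_intros LIMSEQ_realpow_zero) auto
    ultimately have "\<bar>coef f k - c k\<bar> \<le> 2 * 0"
      using LIMSEQ_le_const by blast
    then show ?thesis by simp
  qed
  have "integral\<^sup>L M (\<lambda>x. (f x)\<^sup>2) \<le> s + (1 / 4) ^ n" for n
    using limit(2)[of n] fin_le[OF A(1)[of n]] unfolding S_def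
    by (subst (asm) integral_square_diff_partial_sum[OF fL2 A(1) coef_f]) linarith
  moreover have "(\<lambda>n. s + (1 / 4) ^ n :: real) \<longlonglongrightarrow> s + 0"
    by (intro tendsto_intros LIMSEQ_realpow_zero) auto
  ultimately have "integral\<^sup>L M (\<lambda>x. (f x)\<^sup>2) \<le> s + 0"
    using LIMSEQ_le_const by blast
  with that[OF fL2 coef_f] show thesis by (simp add: s_def)
qed

lemma coef_square_summable:
  assumes "f \<in> L2_per lo hi"
  shows "(\<lambda>k. (coef f k)\<^sup>2) summable_on UNIV"
proof (rule nonneg_bdd_above_summable_on)
  show "bdd_above (sum (\<lambda>k. (coef f k)\<^sup>2) ` {F. F \<subseteq> UNIV \<and> finite F})"
    using Bessel_inequality[OF assms] by (intro bdd_aboveI2) auto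
qed simp

text \<open>
  Riesz--Fischer provides a function \<open>g\<close> with the coefficients of \<open>f\<close> and with the integral of \<open>g\<^sup>2\<close> bounded
  by the sum of their squares.  By completeness of the modes, \<open>f = g\<close> almost everywhere; the converse
  estimate is Bessel's inequality.
\<close>

theorem Parseval_square:
  assumes f: "f \<in> L2_per lo hi"
  shows "((\<lambda>k. (coef f k)\<^sup>2) has_sum integral\<^sup>L M (\<lambda>x. (f x)\<^sup>2)) UNIV"
proof -
  have s: "(\<lambda>k. (coef f k)\<^sup>2) summable_on UNIV" by (rule coef_square_summable[OF f])
  obtain g where g: "g \<in> L2_per lo hi" "\<And>k. coef g k = coef f k"
    "integral\<^sup>L M (\<lambda>x. (g x)\<^sup>2) \<le> (\<Sum>\<^sub>\<infinity>k. (coef f k)\<^sup>2)"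
    using Riesz_Fischer[OF s] by blast
  have "AE x in M. f x - g x = 0"
    using f g by (intro AE_eq_0_if_coef_eq_0 L2_per_diff) (simp_all add: coef_diff)
  then have "AE x in M. (f x)\<^sup>2 = (g x)\<^sup>2" by eventually_elim simp
  then have "integral\<^sup>L M (\<lambda>x. (f x)\<^sup>2) = integral\<^sup>L M (\<lambda>x. (g x)\<^sup>2)"
    using L2_perD(3)[OF f] L2_perD(3)[OF g(1)] by (intro integral_cong_AE) auto
  moreover have "(\<Sum>\<^sub>\<infinity>k. (coef f k)\<^sup>2) \<le> integral\<^sup>L M (\<lambda>x. (f x)\<^sup>2)"
    using s Bessel_inequality[OF f] by (intro infsum_le_finite_sums) auto
  ultimately have "integral\<^sup>L M (\<lambda>x. (f x)\<^sup>2) = (\<Sum>\<^sub>\<infinity>k. (coef f k)\<^sup>2)"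
    using g(3) by simp
  then show ?thesis using s by simp
qed

theorem Parseval:
  assumes f: "f \<in> L2_per lo hi" and g: "g \<in> L2_per lo hi"
  shows "((\<lambda>k. coef f k * coef g k) has_sum integral\<^sup>L M (\<lambda>x. f x * g x)) UNIV"
proof -
  \<comment> \<open>Polarisation reduces the bilinear identity to the quadratic one.\<close>
  have pol: "a * b = (1 / 4) * (a + b)\<^sup>2 + (- 1 / 4) * (a - b)\<^sup>2" for a b :: real
    by (simp add: power2_eq_square algebra_simps)
  have "((\<lambda>k. (1 / 4) * (coef (\<lambda>x. f x + g x) k)\<^sup>2 + (- 1 / 4) * (coef (\<lambda>x. f x - g x) k)\<^sup>2) has_sum
      (1 / 4) * integral\<^sup>L M (\<lambda>x. (f x + g x)\<^sup>2) + (- 1 / 4) * integral\<^sup>L M (\<lambda>x. (f x - g x)\<^sup>2)) UNIV"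
    by (intro has_sum_cmult_right has_sum_add Parseval_square L2_per_add L2_per_diff f g)
  also have "(\<lambda>k. (1 / 4) * (coef (\<lambda>x. f x + g x) k)\<^sup>2 + (- 1 / 4) * (coef (\<lambda>x. f x - g x) k)\<^sup>2)
      = (\<lambda>k. coef f k * coef g k)"
    by (simp only: coef_add[OF f g] coef_diff[OF f g] pol[of "coef f _"])
  also have "(1 / 4) * integral\<^sup>L M (\<lambda>x. (f x + g x)\<^sup>2) + (- 1 / 4) * integral\<^sup>L M (\<lambda>x. (f x - g x)\<^sup>2)
      = integral\<^sup>L M (\<lambda>x. f x * g x)"
    unfolding pol[of "f _"]
    using L2_perD(4)[OF L2_per_add[OF f g]] L2_perD(4)[OF L2_per_diff[OF f g]] by simp
  finally show ?thesis .
qed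

end

section \<open>Weak derivatives and the negative Sobolev norm in Fourier variables\<close>

lemma has_sum_finite_sum:
  fixes f :: "'i \<Rightarrow> 'a \<Rightarrow> real"
  assumes "\<And>i. i \<in> I \<Longrightarrow> (f i has_sum s i) A"
  shows "((\<lambda>k. \<Sum>i\<in>I. f i k) has_sum (\<Sum>i\<in>I. s i)) A"
  using assms by (induction I rule: infinite_finite_induct) (auto intro: has_sum_add)

context torus begin

text \<open>
  Minus the eigenvalue of the Laplacian at the mode \<open>k\<close>.
\<close>

definition freq_sq :: "int^'n \<Rightarrow> real" where
  "freq_sq k = (\<Sum>i\<in>UNIV. (freq k i)\<^sup>2)"

lemma freq_sq_nonneg: "freq_sq k \<ge> 0"
  by (simp add: freq_sq_def sum_nonneg)

lemma freq_sq_0 [simp]: "freq_sq 0 = 0"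
  by (simp add: freq_sq_def)

text \<open>
  The spectral gap: it makes division of coefficients by \<open>freq_sq k\<close> preserve square summability.
\<close>

lemma freq_sq_lower_bound: "\<exists>\<delta>>0. \<forall>k. k \<noteq> 0 \<longrightarrow> \<delta> \<le> freq_sq k"
proof -
  define \<delta> where "\<delta> = Min (range (\<lambda>i. (2 * pi / (hi $ i - lo $ i))\<^sup>2))"
  have "hi $ i - lo $ i \<noteq> 0" for i using lo_less_hi[of i] by simp
  then have "\<delta> > 0" by (simp add: \<delta>_def)
  moreover have "\<delta> \<le> freq_sq k" if "k \<noteq> 0" for k
  proof -
    obtain i where i: "k $ i \<noteq> 0" using \<open>k \<noteq> 0\<close> by (auto simp: vec_eq_iff)
    have "\<delta> \<le> (2 * pi / (hi $ i - lo $ i))\<^sup>2 * 1"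
      by (simp add: \<delta>_def)
    also have "\<dots> \<le> (2 * pi / (hi $ i - lo $ i))\<^sup>2 * (of_int (k $ i))\<^sup>2"
    proof -
      have "1 \<le> (k $ i)\<^sup>2" using i by (simp add: int_one_le_iff_zero_less)
      then have "(1::real) \<le> of_int ((k $ i)\<^sup>2)" by (simp only: of_int_1_le_iff)
      then show ?thesis by (intro mult_left_mono) auto
    qed
    also have "\<dots> = (freq k i)\<^sup>2"
      by (simp add: freq_def power_mult_distrib power_divide)
    also have "\<dots> \<le> freq_sq k"
      unfolding freq_sq_def by (rule member_le_sum) auto
    finally show ?thesis .
  qed
  ultimately show ?thesis by blast
qed

lemma laplacian_scaled_cas_mode:
  "laplacian (\<lambda>x. c * cas_mode k x) = (\<lambda>x. (- freq_sq k * c) * cas_mode k x)"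
proof -
  have "pdiffs [i, i] (\<lambda>x. c * cas_mode k x) = (\<lambda>x. c * (- (freq k i)\<^sup>2 * cas_mode k x))" for i
    by (simp add: pdiffs_def pdiff_scaled_cas_mode) (simp add: power2_eq_square mult_ac)
  then show ?thesis
    by (simp add: laplacian_def freq_sq_def sum_negf sum_distrib_left sum_distrib_right mult_ac fun_eq_iff)
qed

lemma distr_of_eq: "distr_of lo hi f \<eta> = integral\<^sup>L M (\<lambda>x. f x * \<eta> x)"
  by (simp add: distr_of_def box_integral_eq)

lemma distr_of_scaled_cas_mode: "distr_of lo hi f (\<lambda>x. c * cas_mode k x) = c * coef f k"
  by (simp add: distr_of_eq coef_def mult.left_commute[of _ c])

lemma coef_0: "coef f 0 = integral\<^sup>L M f / sqrt vol"
  by (simp add: coef_def cas_mode_0)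

lemma coef_pdiff:
  assumes "\<eta> \<in> test_functions lo hi"
  shows "coef (pdiff i \<eta>) k = - freq k i * coef \<eta> (- k)"
  using integral_by_parts[OF assms cas_mode_test_function, of i k]
  by (simp add: coef_def pdiff_cas_mode mult.left_commute[of _ "freq k i"])

lemma coef_laplacian:
  assumes "\<eta> \<in> test_functions lo hi"
  shows "coef (laplacian \<eta>) k = - freq_sq k * coef \<eta> k"
proof -
  note T = test_functions_pdiff[OF assms] test_functions_pdiff[OF test_functions_pdiff[OF assms]]
  have "coef (laplacian \<eta>) k = (\<Sum>i\<in>UNIV. coef (pdiff i (pdiff i \<eta>)) k)"
    unfolding laplacian_def pdiffs_def using T by (simp add: coef_sum L2_per_test_function)
  also have "\<dots> = (\<Sum>i\<in>UNIV. - (freq k i)\<^sup>2 * coef \<eta> k)"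
    using assms T by (simp add: coef_pdiff power2_eq_square mult.assoc)
  finally show ?thesis by (simp add: freq_sq_def sum_distrib_right sum_negf)
qed

lemma L2_per_laplacian:
  assumes "\<eta> \<in> test_functions lo hi"
  shows "laplacian \<eta> \<in> L2_per lo hi"
  unfolding laplacian_def pdiffs_def foldr.simps o_def id_def
  by (intro L2_per_sum L2_per_test_function test_functions_pdiff assms)

lemma coef_weak_deriv_single:
  assumes "is_weak_deriv lo hi [i] f g"
  shows "coef g k = - freq k i * coef f (- k)"
proof -
  have "box_integral lo hi (\<lambda>x. f x * pdiffs [i] (cas_mode k) x) = - box_integral lo hi (\<lambda>x. g x * cas_mode k x)"
    using assms cas_mode_test_function[of k] by (auto simp: is_weak_deriv_def)
  then show ?thesis
    by (simp add: box_integral_eq pdiffs_def pdiff_cas_mode coef_def mult.left_commute[of _ "freq k i"])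
qed

lemma coef_weak_deriv_twice:
  assumes "is_weak_deriv lo hi [i, i] f g"
  shows "coef g k = - (freq k i)\<^sup>2 * coef f k"
proof -
  have "box_integral lo hi (\<lambda>x. f x * pdiffs [i, i] (cas_mode k) x) = box_integral lo hi (\<lambda>x. g x * cas_mode k x)"
    using assms cas_mode_test_function[of k] by (auto simp: is_weak_deriv_def)
  then show ?thesis
    unfolding pdiffs_twice_cas_mode box_integral_eq by (simp add: coef_def mult.left_commute[of _ "(freq k i)\<^sup>2"])
qed

lemma weak_deriv_H_per:
  assumes "f \<in> H_per m lo hi" "length is \<le> m"
  shows "weak_deriv lo hi is f \<in> L2_per lo hi" "is_weak_deriv lo hi is f (weak_deriv lo hi is f)"
proof -
  have "\<exists>g. g \<in> L2_per lo hi \<and> is_weak_deriv lo hi is f g"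
    using assms by (auto simp: H_per_def)
  from someI_ex[OF this] show "weak_deriv lo hi is f \<in> L2_per lo hi"
    "is_weak_deriv lo hi is f (weak_deriv lo hi is f)"
    by (simp_all add: weak_deriv_def)
qed

lemma bij_uminus_index: "bij_betw (uminus :: int^'n \<Rightarrow> int^'n) UNIV UNIV"
  by (rule bij_uminus)

text \<open>
  Testing the definition of a weak derivative against the modes determines all its coefficients, so
  Parseval's identity yields the same value for every choice of weak derivatives.
\<close>

lemma weak_grad_Parseval:
  assumes f: "f \<in> H_per m lo hi" and m: "m \<ge> 1"
  shows "integrable M (\<lambda>x. (norm (weak_grad lo hi f x))\<^sup>2)"
    and "((\<lambda>k. freq_sq k * (coef f k)\<^sup>2) has_sum
      integral\<^sup>L M (\<lambda>x. (norm (weak_grad lo hi f x))\<^sup>2)) UNIV"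
proof -
  define g where "g i = weak_deriv lo hi [i] f" for i
  have g: "g i \<in> L2_per lo hi" "is_weak_deriv lo hi [i] f (g i)" for i
    using weak_deriv_H_per[OF f, of "[i]"] m by (auto simp: g_def)
  have norm: "(norm (weak_grad lo hi f x))\<^sup>2 = (\<Sum>i\<in>UNIV. (g i x)\<^sup>2)" for x
    unfolding power2_norm_eq_inner by (simp add: inner_vec_def weak_grad_def g_def power2_eq_square)
  show "integrable M (\<lambda>x. (norm (weak_grad lo hi f x))\<^sup>2)"
    unfolding norm using L2_perD(4)[OF g(1)] by simp
  have "((\<lambda>k. (freq k i)\<^sup>2 * (coef f k)\<^sup>2) has_sum integral\<^sup>L M (\<lambda>x. (g i x)\<^sup>2)) UNIV" for i
  proof -
    have "((\<lambda>k. (coef (g i) (- k))\<^sup>2) has_sum integral\<^sup>L M (\<lambda>x. (g i x)\<^sup>2)) UNIV"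
      using Parseval_square[OF g(1)] has_sum_reindex_bij_betw[OF bij_uminus_index, of "\<lambda>k. (coef (g i) k)\<^sup>2"]
      by blast
    then show ?thesis
      by (simp add: coef_weak_deriv_single[OF g(2)] power_mult_distrib)
  qed
  from has_sum_finite_sum[where I=UNIV, OF this]
  show "((\<lambda>k. freq_sq k * (coef f k)\<^sup>2) has_sum
      integral\<^sup>L M (\<lambda>x. (norm (weak_grad lo hi f x))\<^sup>2)) UNIV"
    unfolding norm using L2_perD(4)[OF g(1)] by (simp add: freq_sq_def sum_distrib_right)
qed

lemma weak_laplacian_Parseval:
  assumes f: "f \<in> H_per 2 lo hi"
  shows "integrable M (\<lambda>x. (weak_laplacian lo hi f x)\<^sup>2)"
    and "((\<lambda>k. (freq_sq k)\<^sup>2 * (coef f k)\<^sup>2) has_sum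
      integral\<^sup>L M (\<lambda>x. (weak_laplacian lo hi f x)\<^sup>2)) UNIV"
proof -
  have g: "weak_deriv lo hi [i, i] f \<in> L2_per lo hi"
    "is_weak_deriv lo hi [i, i] f (weak_deriv lo hi [i, i] f)" for i
    using weak_deriv_H_per[OF f, of "[i, i]"] by auto
  have L2: "weak_laplacian lo hi f \<in> L2_per lo hi"
    unfolding weak_laplacian_def by (intro L2_per_sum g)
  then show "integrable M (\<lambda>x. (weak_laplacian lo hi f x)\<^sup>2)"
    by (rule L2_perD(4))
  have "coef (weak_laplacian lo hi f) k = - freq_sq k * coef f k" for k
    unfolding weak_laplacian_def
    by (simp add: coef_sum g coef_weak_deriv_twice[OF g(2)] freq_sq_def sum_distrib_right sum_negf)
  then show "((\<lambda>k. (freq_sq k)\<^sup>2 * (coef f k)\<^sup>2) has_sum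
      integral\<^sup>L M (\<lambda>x. (weak_laplacian lo hi f x)\<^sup>2)) UNIV"
    using Parseval_square[OF L2] by (simp add: power_mult_distrib)
qed

text \<open>
  Both \<open>\<psi>\<close> and its weak partial derivatives \<open>g i\<close> are defined by their coefficients through
  Riesz--Fischer.  The integral identities against an arbitrary test function then hold mode by mode.
  Since \<open>x / 0 = 0\<close>, the formula for \<open>c\<close> also gives mean value zero at \<open>k = 0\<close>.
\<close>

lemma poisson_solution_exists:
  assumes v: "v \<in> L2_per lo hi" and mean: "coef v 0 = 0"
  shows "\<exists>\<psi>. poisson_solution lo hi v \<psi>"
proof -
  obtain \<delta> where \<delta>: "\<delta> > 0" "\<And>k. k \<noteq> 0 \<Longrightarrow> \<delta> \<le> freq_sq k"
    using freq_sq_lower_bound by blast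
  define c where "c k = coef v k / freq_sq k" for k
  have c_freq: "freq_sq k * c k = coef v k" for k
    using mean \<delta>(1) \<delta>(2)[of k] by (cases "k = 0") (auto simp: c_def)
  have c0: "c 0 = 0" by (simp add: c_def)
  have freq_c: "freq_sq k * (c k)\<^sup>2 \<le> (1 / \<delta>) * (coef v k)\<^sup>2" for k
  proof (cases "k = 0")
    case False
    then have "freq_sq k \<ge> \<delta>" "freq_sq k > 0" using \<delta> less_le_trans by blast+
    then have "freq_sq k * (c k)\<^sup>2 = (1 / freq_sq k) * (coef v k)\<^sup>2"
      by (simp add: c_def power2_eq_square)
    also have "\<dots> \<le> (1 / \<delta>) * (coef v k)\<^sup>2"
      using \<open>freq_sq k \<ge> \<delta>\<close> \<delta>(1) by (intro mult_right_mono divide_left_mono) auto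
    finally show ?thesis .
  qed (use \<delta>(1) in simp)
  have sv: "(\<lambda>k. C * (coef v k)\<^sup>2) summable_on UNIV" for C
    by (intro summable_on_cmult_right coef_square_summable v)
  have sc: "(\<lambda>k. (c k)\<^sup>2) summable_on UNIV"
  proof (rule summable_on_comparison_test[OF sv[of "1 / \<delta> * (1 / \<delta>)"]])
    show "(c k)\<^sup>2 \<le> 1 / \<delta> * (1 / \<delta>) * (coef v k)\<^sup>2" for k
    proof (cases "k = 0")
      case False
      have "\<delta> * (c k)\<^sup>2 \<le> freq_sq k * (c k)\<^sup>2"
        using \<delta>(2)[OF False] by (intro mult_right_mono) auto
      also note freq_c[of k]
      finally show ?thesis using \<delta>(1) by (simp add: field_simps)
    qed (simp add: c0 \<delta>(1))
  qed simp
  have sd: "(\<lambda>k. (- freq k i * c (- k))\<^sup>2) summable_on UNIV" for i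
  proof -
    have "(\<lambda>k. (freq k i * c k)\<^sup>2) summable_on UNIV"
    proof (rule summable_on_comparison_test[OF sv[of "1 / \<delta>"]])
      fix k
      have "(freq k i)\<^sup>2 \<le> freq_sq k"
        unfolding freq_sq_def by (rule member_le_sum) auto
      then have "(freq k i * c k)\<^sup>2 \<le> freq_sq k * (c k)\<^sup>2"
        unfolding power_mult_distrib by (rule mult_right_mono) simp
      also note freq_c[of k]
      finally show "(freq k i * c k)\<^sup>2 \<le> (1 / \<delta>) * (coef v k)\<^sup>2" .
    qed simp
    then show ?thesis
      using summable_on_reindex_bij_betw[OF bij_uminus_index, of "\<lambda>k. (freq k i * c k)\<^sup>2"]
      by simp
  qed
  obtain \<psi> where \<psi>: "\<psi> \<in> L2_per lo hi" "\<And>k. coef \<psi> k = c k"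
    using Riesz_Fischer[OF sc] by metis
  have "\<exists>g. g \<in> L2_per lo hi \<and> (\<forall>k. coef g k = - freq k i * c (- k))" for i
    using Riesz_Fischer[OF sd[of i]] by metis
  then obtain g where g: "\<And>i. g i \<in> L2_per lo hi" "\<And>i k. coef (g i) k = - freq k i * c (- k)"
    by metis
  have wd: "is_weak_deriv lo hi [i] \<psi> (g i)" for i
    unfolding is_weak_deriv_def
  proof
    fix \<eta> assume \<eta>: "\<eta> \<in> test_functions lo hi"
    have "((\<lambda>k. - (c k * (freq k i * coef \<eta> (- k)))) has_sum integral\<^sup>L M (\<lambda>x. \<psi> x * pdiff i \<eta> x)) UNIV"
      using Parseval[OF \<psi>(1) L2_per_test_function[OF test_functions_pdiff[OF \<eta>]], of i]
      by (simp add: \<psi>(2) coef_pdiff[OF \<eta>])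
    moreover have "((\<lambda>k. c k * (freq k i * coef \<eta> (- k))) has_sum integral\<^sup>L M (\<lambda>x. g i x * \<eta> x)) UNIV"
    proof -
      have "((\<lambda>k. - freq k i * c (- k) * coef \<eta> k) has_sum integral\<^sup>L M (\<lambda>x. g i x * \<eta> x)) UNIV"
        using Parseval[OF g(1) L2_per_test_function[OF \<eta>], of i] by (simp only: g(2))
      then have "((\<lambda>k. - freq (- k) i * c (- (- k)) * coef \<eta> (- k)) has_sum integral\<^sup>L M (\<lambda>x. g i x * \<eta> x)) UNIV"
        using has_sum_reindex_bij_betw[OF bij_uminus_index, of "\<lambda>k. - freq k i * c (- k) * coef \<eta> k"] by blast
      then show ?thesis by (simp add: mult_ac)
    qed
    then have "((\<lambda>k. - (c k * (freq k i * coef \<eta> (- k)))) has_sum - integral\<^sup>L M (\<lambda>x. g i x * \<eta> x)) UNIV"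
      by (rule has_sum_uminusI)
    ultimately have "integral\<^sup>L M (\<lambda>x. \<psi> x * pdiff i \<eta> x) = - integral\<^sup>L M (\<lambda>x. g i x * \<eta> x)"
      by (rule has_sum_unique)
    then show "box_integral lo hi (\<lambda>x. \<psi> x * pdiffs [i] \<eta> x) =
        (- 1) ^ length [i] * box_integral lo hi (\<lambda>x. g i x * \<eta> x)"
      by (simp add: box_integral_eq pdiffs_def)
  qed
  have "\<psi> \<in> H_per 1 lo hi"
    unfolding H_per_def
  proof (intro CollectI conjI allI impI \<psi>(1))
    fix "is" :: "'n list" assume "length is \<le> 1"
    then consider "is = []" | i where "is = [i]"
      by (cases "is") auto
    then show "\<exists>g\<in>L2_per lo hi. is_weak_deriv lo hi is \<psi> g"
    proof cases
      case 1
      then show ?thesis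
        by (intro bexI[OF _ \<psi>(1)]) (simp add: is_weak_deriv_def pdiffs_def)
    next
      case 2
      then show ?thesis using g(1) wd by blast
    qed
  qed
  moreover have "box_integral lo hi \<psi> = 0"
    using \<psi>(2)[of 0] vol_pos by (simp add: box_integral_eq coef_0 c0)
  moreover have "- distr_laplacian (distr_of lo hi \<psi>) \<eta> = distr_of lo hi v \<eta>"
    if \<eta>: "\<eta> \<in> test_functions lo hi" for \<eta>
  proof -
    have "((\<lambda>k. - (coef v k * coef \<eta> k)) has_sum integral\<^sup>L M (\<lambda>x. \<psi> x * laplacian \<eta> x)) UNIV"
      using Parseval[OF \<psi>(1) L2_per_laplacian[OF \<eta>]]
      by (simp add: \<psi>(2) coef_laplacian[OF \<eta>] mult_ac flip: c_freq)
    moreover have "((\<lambda>k. - (coef v k * coef \<eta> k)) has_sum - integral\<^sup>L M (\<lambda>x. v x * \<eta> x)) UNIV"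
      by (intro has_sum_uminusI Parseval v L2_per_test_function \<eta>)
    ultimately have "integral\<^sup>L M (\<lambda>x. \<psi> x * laplacian \<eta> x) = - integral\<^sup>L M (\<lambda>x. v x * \<eta> x)"
      by (rule has_sum_unique)
    then show ?thesis
      by (simp add: distr_laplacian_def distr_of_eq)
  qed
  ultimately show ?thesis
    unfolding poisson_solution_def by blast
qed

lemma coef_poisson_solution:
  assumes "poisson_solution lo hi v \<psi>"
  shows "freq_sq k * coef \<psi> k = coef v k"
proof -
  have "- distr_laplacian (distr_of lo hi \<psi>) (\<lambda>x. 1 * cas_mode k x) = distr_of lo hi v (\<lambda>x. 1 * cas_mode k x)"
    using assms scaled_cas_mode_test_function[of 1 k] unfolding poisson_solution_def by blast
  then show ?thesis
    by (simp only: distr_laplacian_def laplacian_scaled_cas_mode distr_of_scaled_cas_mode)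
qed

text \<open>
  The coefficients of any solution \<open>\<psi>\<close> of the Poisson problem at \<open>k \<noteq> 0\<close> are those of \<open>v\<close> divided by
  \<open>freq_sq k\<close>, and the gradient contributes a factor \<open>freq_sq k\<close> to their squares.  At \<open>k = 0\<close> both sides are
  zero, by the convention \<open>x / 0 = 0\<close>.
\<close>

theorem Hm1_norm_Parseval:
  assumes v: "v \<in> L2_per lo hi" and mean: "coef v 0 = 0"
  shows "((\<lambda>k. (coef v k)\<^sup>2 / freq_sq k) has_sum (Hm1_norm lo hi v)\<^sup>2) UNIV"
proof -
  define \<psi> where "\<psi> = (SOME \<psi>. poisson_solution lo hi v \<psi>)"
  have \<psi>: "poisson_solution lo hi v \<psi>"
    unfolding \<psi>_def using poisson_solution_exists[OF assms] by (rule someI_ex)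
  have "freq_sq k * (coef \<psi> k)\<^sup>2 = (coef v k)\<^sup>2 / freq_sq k" for k
    using coef_poisson_solution[OF \<psi>, of k, symmetric]
    by (cases "freq_sq k = 0") (auto simp: power2_eq_square)
  moreover have "(Hm1_norm lo hi v)\<^sup>2 = integral\<^sup>L M (\<lambda>x. (norm (weak_grad lo hi \<psi> x))\<^sup>2)"
    by (simp add: Hm1_norm_def \<psi>_def[symmetric] box_integral_eq)
  moreover have "\<psi> \<in> H_per 1 lo hi" using \<psi> by (simp add: poisson_solution_def)
  ultimately show ?thesis
    using weak_grad_Parseval(2)[of \<psi> 1] by simp
qed

end

section \<open>The discrete energy law\<close>

lemma second_order_Taylor_bound:
  fixes F :: "real \<Rightarrow> real"
  assumes F: "C2_function F" and bound: "\<And>s. \<bar>deriv (deriv F) s\<bar> \<le> L"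
  shows "\<bar>F y - F x - deriv F x * (y - x)\<bar> \<le> L / 2 * (y - x)\<^sup>2"
    and "\<bar>deriv F y - deriv F x\<bar> \<le> L * \<bar>y - x\<bar>"
proof -
  have "(F has_real_derivative deriv F t) (at t)" "(deriv F has_real_derivative deriv (deriv F) t) (at t)" for t
    using F by (auto simp: C2_function_def differentiable_on_def DERIV_deriv_iff_real_differentiable)
  note deriv = this
  define diff where "diff m = (if m = 0 then F else if m = 1 then deriv F else deriv (deriv F))" for m :: nat
  have D: "\<forall>m t. m < 2 \<and> min x y \<le> t \<and> t \<le> max x y \<longrightarrow> (diff m has_real_derivative diff (Suc m) t) (at t)"
    using deriv by (auto simp: diff_def less_2_cases_iff)
  show "\<bar>F y - F x - deriv F x * (y - x)\<bar> \<le> L / 2 * (y - x)\<^sup>2"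
  proof (cases "x = y")
    case False
    then obtain t where "F y = (\<Sum>m<2. (diff m x / fact m) * (y - x) ^ m) + (diff 2 t / fact 2) * (y - x) ^ 2"
      using Taylor[of 2 diff F "min x y" "max x y" x y] D by (auto simp: diff_def)
    then have "F y - F x - deriv F x * (y - x) = deriv (deriv F) t / 2 * (y - x)\<^sup>2"
      by (simp add: diff_def numeral_2_eq_2)
    then have "\<bar>F y - F x - deriv F x * (y - x)\<bar> = \<bar>deriv (deriv F) t\<bar> / 2 * (y - x)\<^sup>2"
      by (simp only: abs_mult abs_divide) simp
    then show ?thesis
      using mult_right_mono[OF bound[of t], of "(y - x)\<^sup>2"] by simp
  qed simp
  show "\<bar>deriv F y - deriv F x\<bar> \<le> L * \<bar>y - x\<bar>"
    using field_differentiable_bound[of UNIV "deriv F" "deriv (deriv F)" L y x] deriv(2) bound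
    by (auto simp: has_field_derivative_at_within)
qed

text \<open>
  The energy law for a single mode: \<open>q\<close> is the eigenvalue of the negative Laplacian, \<open>p\<close> and \<open>p'\<close> are the
  coefficients of the old and the new iterate, \<open>b\<close> is that of \<open>F' (\<phi>)\<close> and \<open>m\<close> that of the chemical
  potential.  Expanding \<open>p'\<^sup>2 - p\<^sup>2\<close> as \<open>2 p' w - w\<^sup>2\<close> in the implicit terms and as \<open>2 p w + w\<^sup>2\<close> in the explicit
  gradient term shows that the left-hand side is \<open>m w\<close> minus a nonnegative multiple of \<open>w\<^sup>2\<close>.
\<close>

lemma energy_law_modewise:
  fixes p p' :: real
  assumes w: "w = p' - p" and q: "q \<ge> 0" and a: "1 - r + a > 0" and dt: "dt > 0"
    and m: "m = (1 - r + a) * p' + q\<^sup>2 * p' + b - a * p - 2 * q * p"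
    and scheme: "w / dt = - q * m"
  shows "b * w + a / 2 * w\<^sup>2 + (1 - r) / 2 * (p'\<^sup>2 - p\<^sup>2) - (q * p'\<^sup>2 - q * p\<^sup>2)
    + 1 / 2 * (q\<^sup>2 * p'\<^sup>2 - q\<^sup>2 * p\<^sup>2) \<le> - (1 / dt) * (w\<^sup>2 / q)"
proof -
  have "b * w + a / 2 * w\<^sup>2 + (1 - r) / 2 * (p'\<^sup>2 - p\<^sup>2) - (q * p'\<^sup>2 - q * p\<^sup>2)
      + 1 / 2 * (q\<^sup>2 * p'\<^sup>2 - q\<^sup>2 * p\<^sup>2) = m * w - ((1 - r + a) / 2 + q + q\<^sup>2 / 2) * w\<^sup>2"
    unfolding m w by (simp add: power2_eq_square field_simps)
  also have "\<dots> \<le> m * w"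
    using a q by (simp add: add_nonneg_nonneg)
  also have "m * w = - (1 / dt) * (w\<^sup>2 / q)"
  proof (cases "q = 0")
    case True
    then show ?thesis using scheme dt by simp
  next
    case False
    have "m = - (1 / dt) * (w / q)" using scheme False by (simp add: field_simps)
    then show ?thesis by (simp add: power2_eq_square)
  qed
  finally show ?thesis .
qed

context torus begin

text \<open>
  The bound on the second derivative makes \<open>F\<close> grow at most quadratically and \<open>deriv F\<close> at most linearly,
  so both compositions inherit integrability from \<open>f\<^sup>2\<close>.
\<close>

lemma integrable_comp_C2:
  assumes F: "C2_function F" and bound: "\<And>s. \<bar>deriv (deriv F) s\<bar> \<le> L" and f: "f \<in> L2_per lo hi"
  shows "integrable M (\<lambda>x. F (f x))" and "(\<lambda>x. deriv F (f x)) \<in> L2_per lo hi"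
proof -
  note Taylor = second_order_Taylor_bound[OF F bound]
  have L: "L \<ge> 0" using bound[of 0] abs_ge_zero order_trans by blast
  have cont: "continuous_on UNIV F" "continuous_on UNIV (deriv F)"
    using F by (auto simp: C2_function_def differentiable_imp_continuous_on)
  have [measurable]: "F \<in> borel_measurable borel" "deriv F \<in> borel_measurable borel"
    using cont borel_measurable_continuous_onI by auto
  have [measurable]: "f \<in> borel_measurable lebesgue" "f \<in> borel_measurable M"
    using L2_perD[OF f] by auto
  show "integrable M (\<lambda>x. F (f x))"
  proof (rule Bochner_Integration.integrable_bound)
    show "integrable M (\<lambda>x. \<bar>F 0\<bar> + \<bar>deriv F 0\<bar> * \<bar>f x\<bar> + L / 2 * (f x)\<^sup>2)"
      using integrable_L2[OF f] L2_perD(4)[OF f] integrable_L2[OF L2_per_const[of "\<bar>F 0\<bar>"]] by simp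
    have "\<bar>F t\<bar> \<le> \<bar>F 0\<bar> + \<bar>deriv F 0\<bar> * \<bar>t\<bar> + L / 2 * t\<^sup>2" for t
      using Taylor(1)[of t 0] unfolding diff_0_right abs_mult[of "deriv F 0" t, symmetric] by linarith
    then show "AE x in M. norm (F (f x)) \<le> norm (\<bar>F 0\<bar> + \<bar>deriv F 0\<bar> * \<bar>f x\<bar> + L / 2 * (f x)\<^sup>2)"
      using L by simp
  qed simp
  show "(\<lambda>x. deriv F (f x)) \<in> L2_per lo hi"
  proof (rule L2_perI)
    show "box_periodic lo hi (\<lambda>x. deriv F (f x))"
      using L2_perD(1)[OF f] by (simp add: box_periodic_def)
    show "integrable M (\<lambda>x. (deriv F (f x))\<^sup>2)"
    proof (rule Bochner_Integration.integrable_bound)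
      show "integrable M (\<lambda>x. 2 * (deriv F 0)\<^sup>2 + 2 * L\<^sup>2 * (f x)\<^sup>2)"
        using L2_perD(4)[OF f] integrable_L2[OF L2_per_const[of "2 * (deriv F 0)\<^sup>2"]] by simp
      have "(deriv F t)\<^sup>2 \<le> 2 * (deriv F 0)\<^sup>2 + 2 * L\<^sup>2 * t\<^sup>2" for t
      proof -
        have "\<bar>deriv F t - deriv F 0\<bar> \<le> \<bar>L * t\<bar>" using Taylor(2)[of t 0] L by (simp add: abs_mult)
        then have "(deriv F t - deriv F 0)\<^sup>2 \<le> (L * t)\<^sup>2" by (simp only: abs_le_square_iff)
        moreover have "(deriv F t)\<^sup>2 \<le> 2 * (deriv F 0)\<^sup>2 + 2 * (deriv F t - deriv F 0)\<^sup>2"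
          using zero_le_power2[of "deriv F t - 2 * deriv F 0"]
          by (simp add: power2_eq_square algebra_simps)
        ultimately show ?thesis by (simp add: power_mult_distrib)
      qed
      then show "AE x in M. norm ((deriv F (f x))\<^sup>2) \<le> norm (2 * (deriv F 0)\<^sup>2 + 2 * L\<^sup>2 * (f x)\<^sup>2)"
        by simp
    qed simp
  qed measurable
qed

lemma energy_split:
  assumes f: "f \<in> H_per 2 lo hi" and F: "integrable M (\<lambda>x. F (f x))"
  shows "energy lo hi F r f = integral\<^sup>L M (\<lambda>x. F (f x)) + (1 - r) / 2 * integral\<^sup>L M (\<lambda>x. (f x)\<^sup>2)
    - integral\<^sup>L M (\<lambda>x. (norm (weak_grad lo hi f x))\<^sup>2)
    + 1 / 2 * integral\<^sup>L M (\<lambda>x. (weak_laplacian lo hi f x)\<^sup>2)"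
proof -
  have "f \<in> L2_per lo hi" using f by (simp add: H_per_def)
  then show ?thesis
    unfolding energy_def box_integral_eq
    using F L2_perD(4) weak_grad_Parseval(1)[OF f] weak_laplacian_Parseval(1)[OF f] by simp
qed

lemma chemical_potential_scaled_cas_mode:
  "chemical_potential lo hi F r a \<phi> \<phi>' (\<lambda>x. c * cas_mode k x) =
    c * ((1 - r + a) * coef \<phi>' k + (freq_sq k)\<^sup>2 * coef \<phi>' k + coef (\<lambda>x. deriv F (\<phi> x)) k
      - a * coef \<phi> k - 2 * freq_sq k * coef \<phi> k)"
  unfolding chemical_potential_def distr_laplacian_def laplacian_scaled_cas_mode distr_of_scaled_cas_mode
  by (simp add: power2_eq_square algebra_simps)

end

theorem theorem2:
  fixes lo hi :: "real^'n"
    and \<phi> \<phi>' :: "real^'n \<Rightarrow> real"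
    and \<mu> :: "'n distribution"
    and F :: "real \<Rightarrow> real"
    and r M L a dt :: real
  assumes "\<forall>i. lo $ i < hi $ i"
    and "\<phi> \<in> H_per 2 lo hi"
    and "r > 0" and "M > 0"
    and "C2_function F"
    and "\<forall>s. \<bar>s\<bar> \<le> M \<longrightarrow> F s = 1 / 4 * s ^ 4"
    and "\<forall>s. \<bar>deriv (deriv F) s\<bar> \<le> L"
    and "a \<ge> L" and "1 - r + a > 0"
    and "dt > 0"
    and "\<phi>' \<in> H_per 2 lo hi"
    and "\<forall>\<eta>\<in>test_functions lo hi.
           distr_of lo hi (\<lambda>x. (\<phi>' x - \<phi> x) / dt) \<eta> = distr_laplacian \<mu> \<eta>"
    and "\<forall>\<eta>\<in>test_functions lo hi. \<mu> \<eta> = chemical_potential lo hi F r a \<phi> \<phi>' \<eta>"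
  shows "energy lo hi F r \<phi>' + 1 / dt * (Hm1_norm lo hi (\<lambda>x. \<phi>' x - \<phi> x))\<^sup>2
         \<le> energy lo hi F r \<phi>"
proof -
  interpret torus lo hi by unfold_locales (use assms(1) in blast)
  let ?I = "integral\<^sup>L (lebesgue_on (cbox lo hi))"
  note H = \<open>\<phi> \<in> H_per 2 lo hi\<close> \<open>\<phi>' \<in> H_per 2 lo hi\<close>
  note bound = \<open>\<forall>s. \<bar>deriv (deriv F) s\<bar> \<le> L\<close>[rule_format]
  have L2: "\<phi> \<in> L2_per lo hi" "\<phi>' \<in> L2_per lo hi" using H by (simp_all add: H_per_def)
  define w where "w = (\<lambda>x. \<phi>' x - \<phi> x)"
  have w: "w \<in> L2_per lo hi" "coef w k = coef \<phi>' k - coef \<phi> k" for k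
    unfolding w_def using L2 by (simp_all add: L2_per_diff coef_diff)
  define f where "f = (\<lambda>x. deriv F (\<phi> x))"
  have f: "f \<in> L2_per lo hi"
    unfolding f_def by (rule integrable_comp_C2(2)[OF \<open>C2_function F\<close> bound L2(1)])
  note intF = integrable_comp_C2(1)[OF \<open>C2_function F\<close> bound]
  define m where "m k = (1 - r + a) * coef \<phi>' k + (freq_sq k)\<^sup>2 * coef \<phi>' k + coef f k
      - a * coef \<phi> k - 2 * freq_sq k * coef \<phi> k" for k
  have scheme: "coef w k / dt = - freq_sq k * m k" for k
  proof -
    have "(\<lambda>x. w x / dt) = (\<lambda>x. (1 / dt) * w x)" by simp
    then have "coef w k / dt = distr_of lo hi (\<lambda>x. w x / dt) (\<lambda>x. 1 * cas_mode k x)"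
      by (simp only: distr_of_scaled_cas_mode coef_scale) simp
    also have "\<dots> = \<mu> (laplacian (\<lambda>x. 1 * cas_mode k x))"
      using assms(12) scaled_cas_mode_test_function[of 1 k] unfolding w_def distr_laplacian_def by blast
    also have "\<dots> = - freq_sq k * m k"
      unfolding laplacian_scaled_cas_mode m_def f_def
      using assms(13) scaled_cas_mode_test_function[of "- freq_sq k * 1" k]
      by (simp only: chemical_potential_scaled_cas_mode mult_1_right)
    finally show ?thesis .
  qed
  \<comment> \<open>The mode \<open>k = 0\<close> of the scheme is conservation of mass, which makes the \<open>H\<^sup>-\<^sup>1\<close> norm meaningful.\<close>
  have mean: "coef w 0 = 0" using scheme[of 0] \<open>dt > 0\<close> by simp
  \<comment> \<open>The explicit part \<open>F (s) - a / 2 s\<^sup>2\<close> is concave because \<open>a \<ge> L\<close>, so it lies below its tangent.\<close>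
  have convexity: "?I (\<lambda>x. F (\<phi>' x)) - ?I (\<lambda>x. F (\<phi> x)) \<le> ?I (\<lambda>x. f x * w x) + a / 2 * ?I (\<lambda>x. (w x)\<^sup>2)"
  proof -
    have "F (\<phi>' x) - F (\<phi> x) \<le> f x * w x + a / 2 * (w x)\<^sup>2" for x
    proof -
      have "L / 2 * (w x)\<^sup>2 \<le> a / 2 * (w x)\<^sup>2"
        using \<open>a \<ge> L\<close> by (intro mult_right_mono) auto
      then show ?thesis
        using second_order_Taylor_bound(1)[OF \<open>C2_function F\<close> bound, of "\<phi>' x" "\<phi> x"]
        unfolding f_def w_def by linarith
    qed
    then have "?I (\<lambda>x. F (\<phi>' x) - F (\<phi> x)) \<le> ?I (\<lambda>x. f x * w x + a / 2 * (w x)\<^sup>2)"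
      using intF L2 integrable_mult_L2[OF f w(1)] L2_perD(4)[OF w(1)] by (intro integral_mono) auto
    then show ?thesis
      using intF L2 integrable_mult_L2[OF f w(1)] L2_perD(4)[OF w(1)] by simp
  qed
  \<comment> \<open>\<open>T\<close> bounds the energy increment and involves only integrals that Parseval's identity evaluates.\<close>
  define T where "T = ?I (\<lambda>x. f x * w x) + a / 2 * ?I (\<lambda>x. (w x)\<^sup>2)
      + (1 - r) / 2 * (?I (\<lambda>x. (\<phi>' x)\<^sup>2) - ?I (\<lambda>x. (\<phi> x)\<^sup>2))
      - (?I (\<lambda>x. (norm (weak_grad lo hi \<phi>' x))\<^sup>2) - ?I (\<lambda>x. (norm (weak_grad lo hi \<phi> x))\<^sup>2))
      + 1 / 2 * (?I (\<lambda>x. (weak_laplacian lo hi \<phi>' x)\<^sup>2) - ?I (\<lambda>x. (weak_laplacian lo hi \<phi> x)\<^sup>2))"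
  have diff: "((\<lambda>k. g k - h k) has_sum (s - t)) UNIV"
    if "(g has_sum s) UNIV" "(h has_sum t) UNIV" for g h :: "int^'n \<Rightarrow> real" and s t
    using has_sum_add[OF that(1) has_sum_uminusI[OF that(2)]] by simp
  have "((\<lambda>k. coef f k * coef w k + a / 2 * (coef w k)\<^sup>2
      + (1 - r) / 2 * ((coef \<phi>' k)\<^sup>2 - (coef \<phi> k)\<^sup>2)
      - (freq_sq k * (coef \<phi>' k)\<^sup>2 - freq_sq k * (coef \<phi> k)\<^sup>2)
      + 1 / 2 * ((freq_sq k)\<^sup>2 * (coef \<phi>' k)\<^sup>2 - (freq_sq k)\<^sup>2 * (coef \<phi> k)\<^sup>2)) has_sum T) UNIV"
    unfolding T_def
    by (intro has_sum_add diff has_sum_cmult_right Parseval Parseval_square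
        weak_grad_Parseval(2)[of _ 2] weak_laplacian_Parseval(2) L2 H f w(1)) simp_all
  moreover have "((\<lambda>k. - (1 / dt) * ((coef w k)\<^sup>2 / freq_sq k)) has_sum
      - (1 / dt) * (Hm1_norm lo hi w)\<^sup>2) UNIV"
    by (intro has_sum_cmult_right Hm1_norm_Parseval w(1) mean)
  ultimately have "T \<le> - (1 / dt) * (Hm1_norm lo hi w)\<^sup>2"
  proof (rule has_sum_mono)
    fix k
    show "coef f k * coef w k + a / 2 * (coef w k)\<^sup>2
      + (1 - r) / 2 * ((coef \<phi>' k)\<^sup>2 - (coef \<phi> k)\<^sup>2)
      - (freq_sq k * (coef \<phi>' k)\<^sup>2 - freq_sq k * (coef \<phi> k)\<^sup>2)
      + 1 / 2 * ((freq_sq k)\<^sup>2 * (coef \<phi>' k)\<^sup>2 - (freq_sq k)\<^sup>2 * (coef \<phi> k)\<^sup>2)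
      \<le> - (1 / dt) * ((coef w k)\<^sup>2 / freq_sq k)"
      by (rule energy_law_modewise[OF w(2) freq_sq_nonneg \<open>1 - r + a > 0\<close> \<open>dt > 0\<close> m_def scheme])
  qed
  moreover have "energy lo hi F r \<phi>' - energy lo hi F r \<phi> \<le> T"
    using convexity unfolding energy_split[OF H(1) intF[OF L2(1)]] energy_split[OF H(2) intF[OF L2(2)]] T_def
    by (simp add: algebra_simps)
  ultimately show ?thesis
    by (simp add: w_def)
qed

end
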